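(* Let $q$ be a prime power not divisible by $3$. Let $B\subset\mathbb{P}^4$ be the quartic threefold over $\mathbb{F}_q$ defined by $f=0$, where $$f=y_0(y_0^3+y_1^3+y_2^3+y_3^3+y_4^3)+3y_1y_2y_3y_4,$$ and let $\mathrm{He}(B)$ be its Hessian hypersurface. Then $$\#(B\setminus\mathrm{He}(B))(\mathbb{F}_q)=\begin{cases}(q-4)(q-7)(q-13)&\text{if }q\equiv1\pmod 3,\\ (q-2)(q^2-2q-1)&\text{if }q\equiv2\pmod 3.\end{cases}$$
   Context: The Hessian $\mathrm{He}(B)\subset\mathbb{P}^4$ is the hypersurface $$\frac{1}{486}\det\left(\frac{\partial^2 f}{\partial y_i\,\partial y_j}\right)_{0\le i,j\le4}=0,$$ where the left-hand side is computed in $\mathbb{Q}[y_0,\ldots,y_4]$; the result is a polynomial with integer coefficients of content $1$, which is then reduced to $\mathbb{F}_q$. *)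

theory Defs
  imports
    "HOL-Analysis.Analysis"
    "HOL-Library.Poly_Mapping"
    "HOL-Number_Theory.Prime_Powers"
begin

text \<open>
  Polynomials in $y_0, \ldots, y_4$ are finitely supported coefficient functions on exponent
  vectors. The variables are indexed by the numeral type \<^typ>\<open>5\<close>, whose elements are
  \<open>0, 1, 2, 3, 4\<close> (arithmetic modulo 5 is never used).
\<close>

type_synonym 'a poly5 = "(5 \<Rightarrow>\<^sub>0 nat) \<Rightarrow>\<^sub>0 'a"

definition Const5 :: "'a::zero \<Rightarrow> 'a poly5"
  where "Const5 c = Poly_Mapping.single 0 c"

definition Var5 :: "5 \<Rightarrow> 'a::zero_neq_one poly5"
  where "Var5 i = Poly_Mapping.single (Poly_Mapping.single i 1) 1"

definition pderiv5 :: "5 \<Rightarrow> 'a::comm_semiring_1 poly5 \<Rightarrow> 'a poly5"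
  where "pderiv5 i p =
    (\<Sum>m\<in>Poly_Mapping.keys p.
       Poly_Mapping.single (m - Poly_Mapping.single i 1)
         (of_nat (Poly_Mapping.lookup m i) * Poly_Mapping.lookup p m))"

definition eval5 :: "'a::comm_semiring_1 poly5 \<Rightarrow> 'a ^ 5 \<Rightarrow> 'a"
  where "eval5 p v =
    (\<Sum>m\<in>Poly_Mapping.keys p.
       Poly_Mapping.lookup p m * (\<Prod>i\<in>UNIV. (v $ i) ^ Poly_Mapping.lookup m i))"

definition proj_rel :: "('k::field ^ 5) rel"
  where "proj_rel = {(v, w). v \<noteq> 0 \<and> w \<noteq> 0 \<and> (\<exists>c. c \<noteq> 0 \<and> w = c *s v)}"

definition P4 :: "('k::field ^ 5) set set"
  where "P4 = (UNIV - {0}) // proj_rel"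

text \<open>
  The rational points of the hypersurface \<open>p = 0\<close>. For homogeneous \<open>p\<close>, which is the only case
  used, it does not matter which representative of a point is taken.
\<close>

definition hypersurface :: "'k::field poly5 \<Rightarrow> ('k ^ 5) set set"
  where "hypersurface p = {x \<in> P4. \<forall>v\<in>x. eval5 p v = 0}"

definition quartic :: "'a::comm_ring_1 poly5"
  where "quartic =
    Var5 0 * (Var5 0 ^ 3 + Var5 1 ^ 3 + Var5 2 ^ 3 + Var5 3 ^ 3 + Var5 4 ^ 3)
    + 3 * Var5 1 * Var5 2 * Var5 3 * Var5 4"

definition hessian_rat :: "rat poly5"
  where "hessian_rat = Const5 (1 / 486) * det (\<chi> i j. pderiv5 i (pderiv5 j quartic))"

text \<open>
  The determinant is normalised over the rationals; the result has integer coefficients (see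
  \<open>map_hessian_int\<close> at the end), and only then is it reduced to the field. Normalising after the
  reduction would fail in characteristic 2.
\<close>

definition hessian_int :: "int poly5"
  where "hessian_int = (THE h. Poly_Mapping.map of_int h = hessian_rat)"

definition hessian :: "'k::field poly5"
  where "hessian = Poly_Mapping.map of_int hessian_int"

definition quartic_threefold :: "('k::field ^ 5) set set"
  where "quartic_threefold = hypersurface quartic"

definition hessian_threefold :: "('k::field ^ 5) set set"
  where "hessian_threefold = hypersurface hessian"

text \<open>
  The rest of the theory shows that the definite description defining \<open>hessian_int\<close> is satisfied,
  by computing the polynomial.
\<close>

lemma pderiv5_superset:
  assumes "finite A" "Poly_Mapping.keys p \<subseteq> A"
  shows "pderiv5 i p = (\<Sum>m\<in>A. Poly_Mapping.single (m - Poly_Mapping.single i 1)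
         (of_nat (Poly_Mapping.lookup m i) * Poly_Mapping.lookup p m))"
  unfolding pderiv5_def using assms
  by (intro sum.mono_neutral_left) (auto simp: in_keys_iff)

lemma pderiv5_add: "pderiv5 i (p + q) = pderiv5 i p + pderiv5 i q"
proof -
  let ?A = "Poly_Mapping.keys p \<union> Poly_Mapping.keys q"
  have "Poly_Mapping.keys (p + q) \<subseteq> ?A" by (rule Poly_Mapping.keys_add)
  then show ?thesis
    by (simp add: pderiv5_superset[of ?A] lookup_add distrib_left single_add sum.distrib)
qed

lemma pderiv5_single: "pderiv5 i (Poly_Mapping.single m c) =
   Poly_Mapping.single (m - Poly_Mapping.single i 1) (of_nat (Poly_Mapping.lookup m i) * c)"
  by (simp add: pderiv5_superset[of "{m}"])

lemma pderiv5_0: "pderiv5 i 0 = 0" by (simp add: pderiv5_def)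

lemma pderiv5_sum: "pderiv5 i (sum g A) = (\<Sum>a\<in>A. pderiv5 i (g a))"
  by (induction A rule: infinite_finite_induct) (auto simp: pderiv5_0 pderiv5_add)

lemma poly5_expand: "p = (\<Sum>m\<in>Poly_Mapping.keys p. Poly_Mapping.single m
    (Poly_Mapping.lookup p m))"
  by (intro poly_mapping_eqI) (auto simp: lookup_sum lookup_single when_def in_keys_iff)

lemma minus_single5: 
  fixes m n :: "5 \<Rightarrow>\<^sub>0 nat"
  assumes "Poly_Mapping.lookup m i > 0"
  shows "m + n - Poly_Mapping.single i 1 = (m - Poly_Mapping.single i 1) + n"
  using assms by (intro poly_mapping_eqI) (auto simp: lookup_add lookup_minus lookup_single
      when_def)

lemma pderiv5_mult_single:
  fixes c d :: "'a::comm_semiring_1"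
  shows "pderiv5 i (Poly_Mapping.single m c * Poly_Mapping.single n d) =
    pderiv5 i (Poly_Mapping.single m c) * Poly_Mapping.single n d
    + Poly_Mapping.single m c * pderiv5 i (Poly_Mapping.single n d)"
proof -
  have 1: "Poly_Mapping.single (m + n - Poly_Mapping.single i 1) (of_nat (Poly_Mapping.lookup m
      i) * (c * d))
     = Poly_Mapping.single (m - Poly_Mapping.single i 1 + n) (of_nat (Poly_Mapping.lookup m i) *
         (c * d))"
    using minus_single5[of m i n] by (cases "Poly_Mapping.lookup m i") auto
  have 2: "Poly_Mapping.single (m + n - Poly_Mapping.single i 1) (of_nat (Poly_Mapping.lookup n
      i) * (c * d))
     = Poly_Mapping.single (m + (n - Poly_Mapping.single i 1)) (of_nat (Poly_Mapping.lookup n i)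
         * (c * d))"
    using minus_single5[of n i m] by (cases "Poly_Mapping.lookup n i") (auto simp: add.commute)
  show ?thesis
    unfolding mult_single pderiv5_single lookup_add of_nat_add distrib_right single_add 1 2
    by (simp add: mult_ac)
qed

lemma pderiv5_mult: "pderiv5 i (p * q) = pderiv5 i p * q + p * pderiv5 i q"
proof -
  define P Q where "P = Poly_Mapping.lookup p" "Q = Poly_Mapping.lookup q"
  define A C where "A = Poly_Mapping.keys p" "C = Poly_Mapping.keys q"
  have p: "p = (\<Sum>m\<in>A. Poly_Mapping.single m (P m))" and q: "q = (\<Sum>m\<in>C.
      Poly_Mapping.single m (Q m))"
    unfolding P_Q_def A_C_def by (rule poly5_expand)+
  show ?thesis unfolding p q
    by (simp only: sum_product pderiv5_sum pderiv5_mult_single sum.distrib)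
qed

lemma pderiv5_Var: "pderiv5 i (Var5 j) = (if i = j then 1 else 0)"
  unfolding Var5_def by (subst pderiv5_single) (auto simp: lookup_single)

lemma pderiv5_1: "pderiv5 i 1 = 0"
  unfolding single_one[symmetric] pderiv5_single by simp

lemma pderiv5_of_nat: "pderiv5 i (of_nat k) = 0"
  by (induction k) (auto simp: pderiv5_0 pderiv5_add pderiv5_1)

lemma pderiv5_numeral: "pderiv5 i (numeral k) = 0"
  using pderiv5_of_nat[of i "numeral k"] by simp

lemma map_of_int_add: "Poly_Mapping.map of_int (p + q) = (Poly_Mapping.map of_int p +
    Poly_Mapping.map of_int q :: 'a::ring_1 poly5)"
  by (intro poly_mapping_eqI) (auto simp: lookup_add Poly_Mapping.map.rep_eq when_def simp flip:
      of_int_add)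

lemma map_of_int_uminus: "Poly_Mapping.map of_int (- p) = (- Poly_Mapping.map of_int p ::
    'a::ring_1 poly5)"
  by (intro poly_mapping_eqI) (simp add: Poly_Mapping.map.rep_eq when_def)

lemma map_of_int_diff: "Poly_Mapping.map of_int (p - q) = (Poly_Mapping.map of_int p -
    Poly_Mapping.map of_int q :: 'a::ring_1 poly5)"
  using map_of_int_add[of p "-q"] by (simp add: map_of_int_uminus)

lemma map_of_int_single: "Poly_Mapping.map of_int (Poly_Mapping.single m c) =
    (Poly_Mapping.single m (of_int c) :: 'a::ring_1 poly5)"
  by (intro poly_mapping_eqI) (simp add: Poly_Mapping.map.rep_eq lookup_single when_def)

lemma map_of_int_sum: "Poly_Mapping.map of_int (sum g A) = (\<Sum>a\<in>A. Poly_Mapping.map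
    of_int (g a) :: 'a::ring_1 poly5)"
  by (induction A rule: infinite_finite_induct) (auto simp: map_of_int_add
      Poly_Mapping.map_eq_zero_iff)

lemma map_of_int_mult: "Poly_Mapping.map of_int (p * q) = (Poly_Mapping.map of_int p *
    Poly_Mapping.map of_int q :: 'a::comm_ring_1 poly5)"
proof -
  define P Q where "P = Poly_Mapping.lookup p" "Q = Poly_Mapping.lookup q"
  define A C where "A = Poly_Mapping.keys p" "C = Poly_Mapping.keys q"
  have p: "p = (\<Sum>m\<in>A. Poly_Mapping.single m (P m))" and q: "q = (\<Sum>m\<in>C.
      Poly_Mapping.single m (Q m))"
    unfolding P_Q_def A_C_def by (rule poly5_expand)+
  show ?thesis unfolding p q
    by (simp add: sum_product map_of_int_sum mult_single map_of_int_single)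
qed

lemma map_of_int_1: "Poly_Mapping.map of_int 1 = (1 :: 'a::ring_1 poly5)"
  unfolding single_one[symmetric] map_of_int_single by simp

lemma map_of_int_power: "Poly_Mapping.map of_int (p ^ n) = (Poly_Mapping.map of_int p ^ n ::
    'a::comm_ring_1 poly5)"
  by (induction n) (auto simp: map_of_int_mult map_of_int_1)

lemma map_of_int_of_nat: "Poly_Mapping.map of_int (of_nat n) = (of_nat n :: 'a::comm_ring_1 poly5)"
  by (induction n) (auto simp: map_of_int_add map_of_int_1 Poly_Mapping.map_eq_zero_iff)

lemma map_of_int_numeral: "Poly_Mapping.map of_int (numeral n) = (numeral n :: 'a::comm_ring_1
    poly5)"
  using map_of_int_of_nat[of "numeral n"] by simp

lemma map_of_int_Var: "Poly_Mapping.map of_int (Var5 i) = (Var5 i :: 'a::comm_ring_1 poly5)"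
  unfolding Var5_def map_of_int_single by simp

lemma map_of_int_inj: "Poly_Mapping.map of_int p = (Poly_Mapping.map of_int q :: rat poly5)
    \<Longrightarrow> p = q"
proof (intro poly_mapping_eqI)
  fix k
  assume "Poly_Mapping.map of_int p = (Poly_Mapping.map of_int q :: rat poly5)"
  then have "Poly_Mapping.lookup (Poly_Mapping.map of_int p) k = (Poly_Mapping.lookup
      (Poly_Mapping.map of_int q) k :: rat)" by simp
  then show "Poly_Mapping.lookup p k = Poly_Mapping.lookup q k"
    by (auto simp: Poly_Mapping.map.rep_eq when_def split: if_splits)
qed

lemma UNIV_5: "(UNIV :: 5 set) = {0, 1, 2, 3, 4}"
proof (rule sym, rule card_subset_eq)
  show "card {0, 1, 2, 3, 4 :: 5} = card (UNIV :: 5 set)" by simp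
qed auto

definition hessian_explicit :: "'a::comm_ring_1 \<Rightarrow> 'a \<Rightarrow> 'a \<Rightarrow> 'a \<Rightarrow> 'a \<Rightarrow> 'a"
  where "hessian_explicit y0 y1 y2 y3 y4 =
    32*y0^6*y1*y2*y3*y4 - 8*y0^4*y1^3*y2^3 - 8*y0^4*y1^3*y4^3 + 4*y0^3*y1^4*y2*y3*y4 -
    8*y0^4*y1^3*y3^3 - 8*y0^4*y3^3*y4^3 + 18*y0^2*y1^2*y2^2*y3^2*y4^2 + 4*y0^3*y1*y2*y3*y4^4
    + 4*y0^3*y1*y2*y3^4*y4 - 8*y0^4*y2^3*y4^3 + 4*y0^3*y1*y2^4*y3*y4 - 8*y0^4*y2^3*y3^3 +
    y0*y1^6*y2^3 + y0*y1^6*y4^3 - y1^7*y2*y3*y4 + y0*y1^6*y3^3 + y1^4*y2^4*y3*y4 -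
    6*y0*y1^3*y3^3*y4^3 + y1^4*y2*y3*y4^4 + y1^4*y2*y3^4*y4 - 6*y0*y1^3*y2^3*y4^3 -
    6*y0*y1^3*y2^3*y3^3 + y0*y1^3*y2^6 + y0*y2^6*y4^3 - y1*y2^7*y3*y4 - 6*y0*y2^3*y3^3*y4^3
    + y1*y2^4*y3*y4^4 + y1*y2^4*y3^4*y4 + y0*y2^6*y3^3 + y0*y1^3*y3^6 + y0*y3^6*y4^3 +
    y1*y2*y3^4*y4^4 - y1*y2*y3^7*y4 + y0*y2^3*y3^6 + y0*y1^3*y4^6 + y0*y3^3*y4^6 -
    y1*y2*y3*y4^7 + y0*y2^3*y4^6"

lemma det_5: fixes A :: "'a::comm_ring_1^5^5"
  shows "det A = A$0$0 * A$1$1 * A$2$2 * A$3$3 * A$4$4 - A$0$0 * A$1$1 * A$2$2 * A$3$4 * A$4$3 -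
      A$0$0 * A$1$1 * A$2$3 * A$3$2 * A$4$4 + A$0$0 * A$1$1 * A$2$3 * A$3$4 * A$4$2 + A$0$0 *
      A$1$1 * A$2$4 * A$3$2 * A$4$3 - A$0$0 * A$1$1 * A$2$4 * A$3$3 * A$4$2 - A$0$0 * A$1$2 *
      A$2$1 * A$3$3 * A$4$4 + A$0$0 * A$1$2 * A$2$1 * A$3$4 * A$4$3 + A$0$0 * A$1$2 * A$2$3 *
      A$3$1 * A$4$4 - A$0$0 * A$1$2 * A$2$3 * A$3$4 * A$4$1 - A$0$0 * A$1$2 * A$2$4 * A$3$1 *
      A$4$3 + A$0$0 * A$1$2 * A$2$4 * A$3$3 * A$4$1 + A$0$0 * A$1$3 * A$2$1 * A$3$2 * A$4$4 -
      A$0$0 * A$1$3 * A$2$1 * A$3$4 * A$4$2 - A$0$0 * A$1$3 * A$2$2 * A$3$1 * A$4$4 + A$0$0 *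
      A$1$3 * A$2$2 * A$3$4 * A$4$1 + A$0$0 * A$1$3 * A$2$4 * A$3$1 * A$4$2 - A$0$0 * A$1$3 *
      A$2$4 * A$3$2 * A$4$1 - A$0$0 * A$1$4 * A$2$1 * A$3$2 * A$4$3 + A$0$0 * A$1$4 * A$2$1 *
      A$3$3 * A$4$2 + A$0$0 * A$1$4 * A$2$2 * A$3$1 * A$4$3 - A$0$0 * A$1$4 * A$2$2 * A$3$3 *
      A$4$1 - A$0$0 * A$1$4 * A$2$3 * A$3$1 * A$4$2 + A$0$0 * A$1$4 * A$2$3 * A$3$2 * A$4$1 -
      A$0$1 * A$1$0 * A$2$2 * A$3$3 * A$4$4 + A$0$1 * A$1$0 * A$2$2 * A$3$4 * A$4$3 + A$0$1 *
      A$1$0 * A$2$3 * A$3$2 * A$4$4 - A$0$1 * A$1$0 * A$2$3 * A$3$4 * A$4$2 - A$0$1 * A$1$0 *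
      A$2$4 * A$3$2 * A$4$3 + A$0$1 * A$1$0 * A$2$4 * A$3$3 * A$4$2 + A$0$1 * A$1$2 * A$2$0 *
      A$3$3 * A$4$4 - A$0$1 * A$1$2 * A$2$0 * A$3$4 * A$4$3 - A$0$1 * A$1$2 * A$2$3 * A$3$0 *
      A$4$4 + A$0$1 * A$1$2 * A$2$3 * A$3$4 * A$4$0 + A$0$1 * A$1$2 * A$2$4 * A$3$0 * A$4$3 -
      A$0$1 * A$1$2 * A$2$4 * A$3$3 * A$4$0 - A$0$1 * A$1$3 * A$2$0 * A$3$2 * A$4$4 + A$0$1 *
      A$1$3 * A$2$0 * A$3$4 * A$4$2 + A$0$1 * A$1$3 * A$2$2 * A$3$0 * A$4$4 - A$0$1 * A$1$3 *
      A$2$2 * A$3$4 * A$4$0 - A$0$1 * A$1$3 * A$2$4 * A$3$0 * A$4$2 + A$0$1 * A$1$3 * A$2$4 *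
      A$3$2 * A$4$0 + A$0$1 * A$1$4 * A$2$0 * A$3$2 * A$4$3 - A$0$1 * A$1$4 * A$2$0 * A$3$3 *
      A$4$2 - A$0$1 * A$1$4 * A$2$2 * A$3$0 * A$4$3 + A$0$1 * A$1$4 * A$2$2 * A$3$3 * A$4$0 +
      A$0$1 * A$1$4 * A$2$3 * A$3$0 * A$4$2 - A$0$1 * A$1$4 * A$2$3 * A$3$2 * A$4$0 + A$0$2 *
      A$1$0 * A$2$1 * A$3$3 * A$4$4 - A$0$2 * A$1$0 * A$2$1 * A$3$4 * A$4$3 - A$0$2 * A$1$0 *
      A$2$3 * A$3$1 * A$4$4 + A$0$2 * A$1$0 * A$2$3 * A$3$4 * A$4$1 + A$0$2 * A$1$0 * A$2$4 *
      A$3$1 * A$4$3 - A$0$2 * A$1$0 * A$2$4 * A$3$3 * A$4$1 - A$0$2 * A$1$1 * A$2$0 * A$3$3 *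
      A$4$4 + A$0$2 * A$1$1 * A$2$0 * A$3$4 * A$4$3 + A$0$2 * A$1$1 * A$2$3 * A$3$0 * A$4$4 -
      A$0$2 * A$1$1 * A$2$3 * A$3$4 * A$4$0 - A$0$2 * A$1$1 * A$2$4 * A$3$0 * A$4$3 + A$0$2 *
      A$1$1 * A$2$4 * A$3$3 * A$4$0 + A$0$2 * A$1$3 * A$2$0 * A$3$1 * A$4$4 - A$0$2 * A$1$3 *
      A$2$0 * A$3$4 * A$4$1 - A$0$2 * A$1$3 * A$2$1 * A$3$0 * A$4$4 + A$0$2 * A$1$3 * A$2$1 *
      A$3$4 * A$4$0 + A$0$2 * A$1$3 * A$2$4 * A$3$0 * A$4$1 - A$0$2 * A$1$3 * A$2$4 * A$3$1 *
      A$4$0 - A$0$2 * A$1$4 * A$2$0 * A$3$1 * A$4$3 + A$0$2 * A$1$4 * A$2$0 * A$3$3 * A$4$1 +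
      A$0$2 * A$1$4 * A$2$1 * A$3$0 * A$4$3 - A$0$2 * A$1$4 * A$2$1 * A$3$3 * A$4$0 - A$0$2 *
      A$1$4 * A$2$3 * A$3$0 * A$4$1 + A$0$2 * A$1$4 * A$2$3 * A$3$1 * A$4$0 - A$0$3 * A$1$0 *
      A$2$1 * A$3$2 * A$4$4 + A$0$3 * A$1$0 * A$2$1 * A$3$4 * A$4$2 + A$0$3 * A$1$0 * A$2$2 *
      A$3$1 * A$4$4 - A$0$3 * A$1$0 * A$2$2 * A$3$4 * A$4$1 - A$0$3 * A$1$0 * A$2$4 * A$3$1 *
      A$4$2 + A$0$3 * A$1$0 * A$2$4 * A$3$2 * A$4$1 + A$0$3 * A$1$1 * A$2$0 * A$3$2 * A$4$4 -
      A$0$3 * A$1$1 * A$2$0 * A$3$4 * A$4$2 - A$0$3 * A$1$1 * A$2$2 * A$3$0 * A$4$4 + A$0$3 *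
      A$1$1 * A$2$2 * A$3$4 * A$4$0 + A$0$3 * A$1$1 * A$2$4 * A$3$0 * A$4$2 - A$0$3 * A$1$1 *
      A$2$4 * A$3$2 * A$4$0 - A$0$3 * A$1$2 * A$2$0 * A$3$1 * A$4$4 + A$0$3 * A$1$2 * A$2$0 *
      A$3$4 * A$4$1 + A$0$3 * A$1$2 * A$2$1 * A$3$0 * A$4$4 - A$0$3 * A$1$2 * A$2$1 * A$3$4 *
      A$4$0 - A$0$3 * A$1$2 * A$2$4 * A$3$0 * A$4$1 + A$0$3 * A$1$2 * A$2$4 * A$3$1 * A$4$0 +
      A$0$3 * A$1$4 * A$2$0 * A$3$1 * A$4$2 - A$0$3 * A$1$4 * A$2$0 * A$3$2 * A$4$1 - A$0$3 *
      A$1$4 * A$2$1 * A$3$0 * A$4$2 + A$0$3 * A$1$4 * A$2$1 * A$3$2 * A$4$0 + A$0$3 * A$1$4 *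
      A$2$2 * A$3$0 * A$4$1 - A$0$3 * A$1$4 * A$2$2 * A$3$1 * A$4$0 + A$0$4 * A$1$0 * A$2$1 *
      A$3$2 * A$4$3 - A$0$4 * A$1$0 * A$2$1 * A$3$3 * A$4$2 - A$0$4 * A$1$0 * A$2$2 * A$3$1 *
      A$4$3 + A$0$4 * A$1$0 * A$2$2 * A$3$3 * A$4$1 + A$0$4 * A$1$0 * A$2$3 * A$3$1 * A$4$2 -
      A$0$4 * A$1$0 * A$2$3 * A$3$2 * A$4$1 - A$0$4 * A$1$1 * A$2$0 * A$3$2 * A$4$3 + A$0$4 *
      A$1$1 * A$2$0 * A$3$3 * A$4$2 + A$0$4 * A$1$1 * A$2$2 * A$3$0 * A$4$3 - A$0$4 * A$1$1 *
      A$2$2 * A$3$3 * A$4$0 - A$0$4 * A$1$1 * A$2$3 * A$3$0 * A$4$2 + A$0$4 * A$1$1 * A$2$3 *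
      A$3$2 * A$4$0 + A$0$4 * A$1$2 * A$2$0 * A$3$1 * A$4$3 - A$0$4 * A$1$2 * A$2$0 * A$3$3 *
      A$4$1 - A$0$4 * A$1$2 * A$2$1 * A$3$0 * A$4$3 + A$0$4 * A$1$2 * A$2$1 * A$3$3 * A$4$0 +
      A$0$4 * A$1$2 * A$2$3 * A$3$0 * A$4$1 - A$0$4 * A$1$2 * A$2$3 * A$3$1 * A$4$0 - A$0$4 *
      A$1$3 * A$2$0 * A$3$1 * A$4$2 + A$0$4 * A$1$3 * A$2$0 * A$3$2 * A$4$1 + A$0$4 * A$1$3 *
      A$2$1 * A$3$0 * A$4$2 - A$0$4 * A$1$3 * A$2$1 * A$3$2 * A$4$0 - A$0$4 * A$1$3 * A$2$2 *
      A$3$0 * A$4$1 + A$0$4 * A$1$3 * A$2$2 * A$3$1 * A$4$0"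
proof -
  have f4: "finite {1::5, 2, 3, 4}" "0 \<notin> {1::5, 2, 3, 4}" by auto
  have f3: "finite {2::5, 3, 4}" "1 \<notin> {2::5, 3, 4}" by auto
  have f2: "finite {3::5, 4}" "2 \<notin> {3::5, 4}" by auto
  have f1: "finite {4::5}" "3 \<notin> {4::5}" by auto
  show ?thesis unfolding det_def UNIV_5
    unfolding sum_over_permutations_insert[OF f4] sum_over_permutations_insert[OF f3]
        sum_over_permutations_insert[OF f2] sum_over_permutations_insert[OF f1]
    unfolding permutes_sing
    by (simp add: sign_swap_id permutation_swap_id sign_compose sign_id swap_id_eq
        permutation_compose ac_simps)
qed

lemma pderiv5_pow3: "pderiv5 i (p ^ 3) = 3 * p\<^sup>2 * pderiv5 i (p::'a::comm_ring_1 poly5)"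
proof -
  have 3: "(3::'a poly5) = 1 + 1 + 1" by simp
  show ?thesis unfolding 3 by (simp only: power3_eq_cube power2_eq_square pderiv5_mult
      distrib_left distrib_right mult_1_left mult_ac add_ac)
qed

lemma pderiv5_sq: "pderiv5 i (p\<^sup>2) = 2 * p * pderiv5 i (p::'a::comm_ring_1 poly5)"
proof -
  have 2: "(2::'a poly5) = 1 + 1" by simp
  show ?thesis unfolding 2 by (simp only: power2_eq_square pderiv5_mult distrib_left
      distrib_right mult_1_left mult_ac add_ac)
qed

lemma all_5: "(\<forall>i::5. P i) \<longleftrightarrow> P 0 \<and> P 1 \<and> P 2 \<and> P 3
    \<and> P 4"
  using UNIV_5 by (metis (full_types) UNIV_I empty_iff insert_iff)

lemmas pderiv5_quartic_simps = quartic_def pderiv5_add pderiv5_mult pderiv5_pow3 pderiv5_sq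
    pderiv5_numeral pderiv5_Var pderiv5_0 pderiv5_1

definition hessian_entry :: "'a::comm_ring_1 \<Rightarrow> 'a \<Rightarrow> 'a \<Rightarrow> 'a
    \<Rightarrow> 'a \<Rightarrow> 5 \<Rightarrow> 5 \<Rightarrow> 'a" where
 "hessian_entry y0 y1 y2 y3 y4 i j = (
   if i = 0 then (if j = 0 then 12*y0^2 else if j = 1 then 3*y1^2 else if j = 2 then 3*y2^2 else
       if j = 3 then 3*y3^2 else 3*y4^2)
   else if i = 1 then (if j = 0 then 3*y1^2 else if j = 1 then 6*y0*y1 else if j = 2 then
       3*y3*y4 else if j = 3 then 3*y2*y4 else 3*y2*y3)
   else if i = 2 then (if j = 0 then 3*y2^2 else if j = 1 then 3*y3*y4 else if j = 2 then
       6*y0*y2 else if j = 3 then 3*y1*y4 else 3*y1*y3)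
   else if i = 3 then (if j = 0 then 3*y3^2 else if j = 1 then 3*y2*y4 else if j = 2 then
       3*y1*y4 else if j = 3 then 6*y0*y3 else 3*y1*y2)
   else (if j = 0 then 3*y4^2 else if j = 1 then 3*y2*y3 else if j = 2 then 3*y1*y3 else if j =
       3 then 3*y1*y2 else 6*y0*y4))"

lemma hessian_entry_eq: "\<forall>i j. pderiv5 i (pderiv5 j (quartic::'a::comm_ring_1 poly5)) =
    hessian_entry (Var5 0) (Var5 1) (Var5 2) (Var5 3) (Var5 4) i j"
  unfolding all_5 by (simp add: pderiv5_quartic_simps hessian_entry_def algebra_simps
      power2_eq_square power3_eq_cube)

lemma det_hessian_entry: fixes y0 :: "'a::comm_ring_1" shows "det (\<chi> i j. hessian_entry y0
    y1 y2 y3 y4 i j) = 486 * hessian_explicit y0 y1 y2 y3 y4"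
  unfolding det_5 hessian_explicit_def by (simp add: hessian_entry_def) (simp add: algebra_simps
      power_numeral_reduce)

lemma map_hessian_explicit: "Poly_Mapping.map of_int (hessian_explicit (Var5 0) (Var5 1) (Var5
    2) (Var5 3) (Var5 4)) = hessian_rat"
proof -
  have n: "486 = Const5 (486::rat)" unfolding Const5_def by simp
  then have c: "Const5 (1/486::rat) * 486 = 1" by (simp only: n Const5_def mult_single) simp
  have "hessian_rat = (Const5 (1/486) * 486) * hessian_explicit (Var5 0) (Var5 1) (Var5 2) (Var5
      3) (Var5 4)"
    unfolding hessian_rat_def by (simp add: hessian_entry_eq det_hessian_entry mult.assoc)
  then show ?thesis unfolding c
    by (simp add: hessian_explicit_def map_of_int_add map_of_int_diff map_of_int_uminus
        map_of_int_mult map_of_int_power map_of_int_numeral map_of_int_Var)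
qed

lemma map_hessian_int: "Poly_Mapping.map of_int hessian_int = hessian_rat"
  unfolding hessian_int_def by (rule theI[where P="\<lambda>h. Poly_Mapping.map of_int h =
      hessian_rat", OF map_hessian_explicit]) (metis map_hessian_explicit map_of_int_inj)

end

theory Submission
  imports Defs "HOL-Number_Theory.Residues"
begin

text \<open>
  If \<open>y\<^sub>0 = 0\<close> then \<open>f = 0\<close> forces the Hessian to vanish, so put \<open>y\<^sub>0 = 1\<close>. Modulo \<open>f\<close> the Hessian is
  then \<open>-9\<close> times the product of the \<open>1 + y\<^sub>i\<^sup>3\<close>, and one has to count the zeros \<open>(u, v, s, t)\<close> of \<open>f\<close>
  with no coordinate a cube root of \<open>-1\<close>.

  With \<open>N(x, y, z) = x\<^sup>3 + y\<^sup>3 + z\<^sup>3 - 3xyz\<close> the equation reads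
  \<open>N(u, v, -st) = -(1 + s\<^sup>3)(1 + t\<^sup>3)\<close>. Since \<open>N\<close> is the norm form of \<open>k[X]/(X\<^sup>3 - 1)\<close>, dividing by
  \<open>1 + tX\<close> for \<open>t\<^sup>3 \<noteq> -1\<close> turns it into the cubic \<open>N(x, y, z) = -(1 + s\<^sup>3)\<close> together with the
  condition \<open>z = -t(y + s)\<close>, which is linear in \<open>t\<close>. All loci arising on the cubic can be counted
  because \<open>N\<close> splits off a linear factor. The remaining coordinates are treated by
  inclusion and exclusion: fixing one of them to be a cube root of \<open>-1\<close> turns \<open>f\<close> into \<open>N\<close>.
\<close>

section \<open>The complement of the Hessian in affine coordinates\<close>

lemma eval5_superset:
  assumes "finite A" "Poly_Mapping.keys p \<subseteq> A"
  shows "eval5 p v = (\<Sum>m\<in>A. Poly_Mapping.lookup p m * (\<Prod>i\<in>UNIV. (v $ i) ^ Poly_Mapping.lookup m i))"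
  unfolding eval5_def using assms
  by (intro sum.mono_neutral_left) (auto simp: in_keys_iff)

lemma eval5_add: "eval5 (p + q) v = eval5 p v + eval5 q v"
proof -
  let ?A = "Poly_Mapping.keys p \<union> Poly_Mapping.keys q"
  have "Poly_Mapping.keys (p + q) \<subseteq> ?A" by (rule Poly_Mapping.keys_add)
  then show ?thesis
    by (simp add: eval5_superset[of ?A] lookup_add distrib_right sum.distrib)
qed

lemma eval5_single:
  "eval5 (Poly_Mapping.single m c) v = c * (\<Prod>i\<in>UNIV. (v $ i) ^ Poly_Mapping.lookup m i)"
  by (simp add: eval5_superset[of "{m}"])

lemma eval5_0: "eval5 0 v = 0"
  by (simp add: eval5_def)

lemma eval5_sum: "eval5 (sum g A) v = (\<Sum>a\<in>A. eval5 (g a) v)"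
  by (induction A rule: infinite_finite_induct) (auto simp: eval5_0 eval5_add)

lemma eval5_mult: "eval5 (p * q) v = eval5 p v * eval5 q v"
proof -
  define P Q where "P = Poly_Mapping.lookup p" "Q = Poly_Mapping.lookup q"
  define A C where "A = Poly_Mapping.keys p" "C = Poly_Mapping.keys q"
  have p: "p = (\<Sum>m\<in>A. Poly_Mapping.single m (P m))"
    and q: "q = (\<Sum>m\<in>C. Poly_Mapping.single m (Q m))"
    unfolding P_Q_def A_C_def by (rule poly5_expand)+
  show ?thesis unfolding p q
    by (simp add: sum_product eval5_sum mult_single eval5_single lookup_add power_add
        prod.distrib mult_ac)
qed

lemma eval5_1: "eval5 1 v = 1"
  unfolding single_one[symmetric] eval5_single by simp

lemma eval5_power: "eval5 (p ^ n) v = eval5 p v ^ n"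
  by (induction n) (auto simp: eval5_1 eval5_mult)

lemma eval5_of_nat: "eval5 (of_nat n) v = of_nat n"
  by (induction n) (auto simp: eval5_0 eval5_1 eval5_add)

lemma eval5_numeral: "eval5 (numeral n) v = numeral n"
  using eval5_of_nat[of "numeral n" v] by simp

lemma eval5_Var: "eval5 (Var5 i) v = v $ i"
proof -
  have "(\<Prod>j\<in>UNIV. (v $ j) ^ Poly_Mapping.lookup (Poly_Mapping.single i 1) j) = 
      (\<Prod>j\<in>{i}. (v $ j) ^ Poly_Mapping.lookup (Poly_Mapping.single i (1::nat)) j)"
    by (intro prod.mono_neutral_right) (auto simp: lookup_single when_def)
  then show ?thesis unfolding Var5_def eval5_single by (simp add: lookup_single)
qed

lemma eval5_diff: "eval5 (p - q) v = eval5 p v - eval5 (q :: 'a::comm_ring_1 poly5) v"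
  using eval5_add[of "p - q" q v] by (simp add: algebra_simps)

lemma eval5_uminus: "eval5 (- p) v = - eval5 (p :: 'a::comm_ring_1 poly5) v"
  using eval5_diff[of 0 p v] by (simp add: eval5_0)

lemmas eval5_simps = eval5_add eval5_diff eval5_uminus eval5_mult eval5_power eval5_numeral
  eval5_Var

section \<open>The quartic and its Hessian as functions of the coordinates\<close>

definition quartic_explicit :: "'a::comm_ring_1 \<Rightarrow> 'a \<Rightarrow> 'a \<Rightarrow> 'a \<Rightarrow> 'a \<Rightarrow> 'a"
  where "quartic_explicit a u v s t =
    a * (a ^ 3 + u ^ 3 + v ^ 3 + s ^ 3 + t ^ 3) + 3 * u * v * s * t"

lemma eval5_quartic:
  "eval5 quartic v = quartic_explicit (v $ 0) (v $ 1) (v $ 2) (v $ 3) (v $ 4)"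
  by (simp add: quartic_def quartic_explicit_def eval5_simps)

text \<open>Both sides map to \<open>hessian_rat\<close>, and extending integer coefficients to the
  rationals is injective; this resolves the definite description.\<close>

lemma hessian_int_eq:
  "hessian_int = hessian_explicit (Var5 0) (Var5 1) (Var5 2) (Var5 3) (Var5 4)"
  using map_of_int_inj map_hessian_int map_hessian_explicit by metis

text \<open>Mapping integer coefficients into the field commutes with ring operations, so the
  normalised formula holds in every characteristic, 2 included.\<close>

lemma eval5_hessian:
  "eval5 hessian v = hessian_explicit (v $ 0) (v $ 1) (v $ 2) (v $ 3) (v $ 4)"
  unfolding hessian_def hessian_int_eq hessian_explicit_def
  by (simp add: map_of_int_add map_of_int_diff map_of_int_uminus map_of_int_mult
      map_of_int_power map_of_int_numeral map_of_int_Var eval5_simps)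

lemma quartic_explicit_scale:
  "quartic_explicit (c * a) (c * u) (c * v) (c * s) (c * t) = c ^ 4 * quartic_explicit a u v s t"
  unfolding quartic_explicit_def by (simp add: algebra_simps power_numeral_reduce)

text \<open>A 5 by 5 determinant of quadratic forms has degree 10. Homogeneity lets nonvanishing be
  tested after scaling.\<close>

lemma hessian_explicit_scale:
  "hessian_explicit (c * a) (c * u) (c * v) (c * s) (c * t) = c ^ 10 * hessian_explicit a u v s t"
  unfolding hessian_explicit_def by (simp add: algebra_simps power_numeral_reduce)

text \<open>The cofactor comes from polynomial division by the quartic.\<close>

lemma hessian_explicit_1:
  "hessian_explicit 1 u v s t + 9 * ((1 + u^3) * (1 + v^3) * (1 + s^3) * (1 + t^3)) =
    quartic_explicit 1 u v s t *
      (9 + s^3 * t^3 + v^3 * t^3 + v^3 * s^3 + 5 * u * v * s * t - u * v * s * t^4 - u * v * s^4 * t - u * v^4 * s * t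
       + 3 * u^2 * v^2 * s^2 * t^2 + u^3 * t^3 + u^3 * s^3 + u^3 * v^3 - u^4 * v * s * t)"
  unfolding hessian_explicit_def quartic_explicit_def
  by (simp add: algebra_simps power_numeral_reduce)

lemma cube_eq_minus_1_iff: "1 + x ^ 3 = 0 \<longleftrightarrow> x ^ 3 = (-1 :: 'a::comm_ring_1)"
  by (metis add.commute add_eq_0_iff)

text \<open>On the quartic the previous identity leaves \<open>-9\<close> times the product of the
  four factors, and 9 is nonzero because 3 is.\<close>

lemma hessian_explicit_1_eq_0_iff:
  fixes u v s t :: "'k::field"
  assumes "(3::'k) \<noteq> 0" "quartic_explicit 1 u v s t = 0"
  shows "hessian_explicit 1 u v s t = 0 \<longleftrightarrow> u^3 = -1 \<or> v^3 = -1 \<or> s^3 = -1 \<or> t^3 = -1"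
proof -
  have "(9::'k) = 3 * 3" by simp
  then have 9: "(9::'k) \<noteq> 0" using assms(1) by (metis mult_eq_0_iff)
  have "hessian_explicit 1 u v s t = - 9 * ((1 + u^3) * (1 + v^3) * (1 + s^3) * (1 + t^3))"
    using hessian_explicit_1[of u v s t] assms(2)
    by (simp add: eq_neg_iff_add_eq_0)
  then show ?thesis using 9 by (simp add: cube_eq_minus_1_iff)
qed

text \<open>At \<open>a = 0\<close> the quartic is \<open>3 * u * v * s * t\<close>, so some
  coordinate vanishes, while every Hessian monomial without the first variable contains all four
  others.\<close>

lemma hessian_explicit_0_eq_0:
  fixes u v s t :: "'k::field"
  assumes "(3::'k) \<noteq> 0" "quartic_explicit 0 u v s t = 0"
  shows "hessian_explicit 0 u v s t = 0"
  using assms by (auto simp: quartic_explicit_def hessian_explicit_def)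

section \<open>Projective classes and the chart with first coordinate 1\<close>

definition tuple5 :: "'a \<Rightarrow> 'a \<Rightarrow> 'a \<Rightarrow> 'a \<Rightarrow> 'a \<Rightarrow> 'a ^ 5"
  where "tuple5 a u v s t =
    (\<chi> i. if i = 0 then a else if i = 1 then u else if i = 2 then v else if i = 3 then s else t)"

lemma tuple5_nth [simp]:
  "tuple5 a u v s t $ 0 = a" "tuple5 a u v s t $ 1 = u" "tuple5 a u v s t $ 2 = v"
  "tuple5 a u v s t $ 3 = s" "tuple5 a u v s t $ 4 = t"
  by (simp_all add: tuple5_def)

lemma vec5_eq_iff:
  "v = w \<longleftrightarrow> v $ 0 = w $ 0 \<and> v $ 1 = w $ 1 \<and> v $ 2 = w $ 2 \<and> v $ 3 = w $ 3 \<and> v $ (4::5) = w $ 4"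
  unfolding vec_eq_iff all_5 ..

lemma equiv_proj_rel: "equiv (UNIV - {0}) (proj_rel :: ('k::field ^ 5) rel)"
proof (rule equivI)
  show "proj_rel \<subseteq> (UNIV - {0}) \<times> (UNIV - {0 :: 'k ^ 5})"
    by (auto simp: proj_rel_def)
  show "refl_on (UNIV - {0}) (proj_rel :: ('k ^ 5) rel)"
    by (auto simp: refl_on_def proj_rel_def intro!: exI[of _ 1])
  show "sym (proj_rel :: ('k ^ 5) rel)"
  proof (rule symI)
    fix v w :: "'k ^ 5"
    assume "(v, w) \<in> proj_rel"
    then obtain c where "v \<noteq> 0" "w \<noteq> 0" "c \<noteq> 0" "w = c *s v" by (auto simp: proj_rel_def)
    then show "(w, v) \<in> proj_rel"
      by (auto simp: proj_rel_def intro!: exI[of _ "inverse c"])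
  qed
  show "trans (proj_rel :: ('k ^ 5) rel)"
  proof (rule transI)
    fix u v w :: "'k ^ 5"
    assume "(u, v) \<in> proj_rel" "(v, w) \<in> proj_rel"
    then obtain c d where "u \<noteq> 0" "w \<noteq> 0" "c \<noteq> 0" "v = c *s u" "d \<noteq> 0" "w = d *s v"
      by (auto simp: proj_rel_def)
    then show "(u, w) \<in> proj_rel"
      by (auto simp: proj_rel_def intro!: exI[of _ "d * c"])
  qed
qed

text \<open>The conditions on the cubes stand for nonvanishing of the Hessian, to which they are
  equivalent on the quartic if 3 is nonzero.\<close>

definition affine_points_off_hessian :: "('k::field \<times> 'k \<times> 'k \<times> 'k) set"
  where "affine_points_off_hessian = {(u, v, s, t). quartic_explicit 1 u v s t = 0 \<and>
    u^3 \<noteq> -1 \<and> v^3 \<noteq> -1 \<and> s^3 \<noteq> -1 \<and> t^3 \<noteq> -1}"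

lemma proj_rel_tuple5_1_iff:
  "(tuple5 1 u v s t, w) \<in> proj_rel \<longleftrightarrow>
     (\<exists>c. c \<noteq> 0 \<and> w = tuple5 c (c * u) (c * v) (c * s) (c * t :: 'k::field))"
  by (auto simp: proj_rel_def vec5_eq_iff)

text \<open>A point of the quartic off the Hessian has nonzero first coordinate, hence exactly one
  representative where that coordinate is 1.\<close>

lemma bij_betw_quartic_minus_hessian:
  assumes three: "(3::'k::field) \<noteq> 0"
  shows "bij_betw (\<lambda>(u, v, s, t). proj_rel `` {tuple5 1 u v s t})
    affine_points_off_hessian (quartic_threefold - hessian_threefold :: ('k ^ 5) set set)"
    (is "bij_betw ?\<phi> _ ?B")
proof (rule bij_betw_imageI)
  have nz: "tuple5 1 u v s t \<in> UNIV - {0 :: 'k ^ 5}" for u v s t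
    by (simp add: vec5_eq_iff)
  show "inj_on ?\<phi> affine_points_off_hessian"
  proof (rule inj_onI, simp only: split_paired_all prod.case)
    fix u v s t u' v' s' t' :: 'k
    assume "proj_rel `` {tuple5 1 u v s t} = proj_rel `` {tuple5 1 u' v' s' t'}"
    then have "(tuple5 1 u v s t, tuple5 1 u' v' s' t') \<in> proj_rel"
      using eq_equiv_class[OF _ equiv_proj_rel] nz by blast
    \<comment> \<open>Comparing first coordinates forces the scalar to be 1.\<close>
    then show "(u, v, s, t) = (u', v', s', t')"
      by (auto simp: proj_rel_tuple5_1_iff vec5_eq_iff)
  qed
  show "?\<phi> ` affine_points_off_hessian = ?B"
  proof (intro equalityI subsetI)
    fix x assume "x \<in> ?\<phi> ` affine_points_off_hessian"
    then obtain u v s t where x: "x = proj_rel `` {tuple5 1 u v s t}"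
      and q: "quartic_explicit 1 u v s t = 0"
      and g: "u^3 \<noteq> -1" "v^3 \<noteq> -1" "s^3 \<noteq> -1" "t^3 \<noteq> -1"
      by (auto simp: affine_points_off_hessian_def)
    have "x \<in> P4" unfolding x P4_def by (rule quotientI[OF nz])
    moreover have "eval5 quartic w = 0" if "w \<in> x" for w
      using that q quartic_explicit_scale[of _ 1 u v s t]
      by (auto simp: x proj_rel_tuple5_1_iff eval5_quartic)
    moreover have "tuple5 1 u v s t \<in> x"
      unfolding x by (rule equiv_class_self[OF equiv_proj_rel nz])
    \<comment> \<open>Membership in the Hessian requires vanishing at all representatives, so one
      nonzero value excludes the point.\<close>
    moreover have "eval5 hessian (tuple5 1 u v s t) \<noteq> 0"
      using hessian_explicit_1_eq_0_iff[OF three q] g by (simp add: eval5_hessian)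
    ultimately show "x \<in> ?B"
      by (auto simp: quartic_threefold_def hessian_threefold_def hypersurface_def)
  next
    fix x assume "x \<in> ?B"
    then have x: "x \<in> P4" "\<And>v. v \<in> x \<Longrightarrow> eval5 quartic v = 0"
      and "\<exists>v\<in>x. eval5 hessian v \<noteq> 0"
      by (auto simp: quartic_threefold_def hessian_threefold_def hypersurface_def)
    then obtain w where w: "w \<in> x" "eval5 hessian w \<noteq> 0" by blast
    have q: "quartic_explicit (w $ 0) (w $ 1) (w $ 2) (w $ 3) (w $ 4) = 0"
      using x(2)[OF w(1)] by (simp add: eval5_quartic)
    have h: "hessian_explicit (w $ 0) (w $ 1) (w $ 2) (w $ 3) (w $ 4) \<noteq> 0"
      using w(2) by (simp add: eval5_hessian)
    define c where "c = w $ 0"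
    have c: "c \<noteq> 0"
      using q h hessian_explicit_0_eq_0[OF three] unfolding c_def by metis
    define u v s t where "u = w $ 1 / c" "v = w $ 2 / c" "s = w $ 3 / c" "t = w $ 4 / c"
    have w_eq: "w = tuple5 c (c * u) (c * v) (c * s) (c * t)"
      using c by (simp add: vec5_eq_iff u_v_s_t_def c_def)
    have q1: "quartic_explicit 1 u v s t = 0"
      using q c quartic_explicit_scale[of c 1 u v s t] unfolding w_eq by simp
    have "hessian_explicit 1 u v s t \<noteq> 0"
      using h c hessian_explicit_scale[of c 1 u v s t] unfolding w_eq by simp
    then have good: "(u, v, s, t) \<in> affine_points_off_hessian"
      using q1 hessian_explicit_1_eq_0_iff[OF three q1] by (simp add: affine_points_off_hessian_def)
    have rel: "(tuple5 1 u v s t, w) \<in> proj_rel"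
      using c w_eq by (auto simp: proj_rel_tuple5_1_iff)
    obtain z where z: "x = proj_rel `` {z}"
      using x(1) unfolding P4_def by (auto elim: quotientE)
    then have "(z, w) \<in> proj_rel" using w(1) by simp
    then have "x = proj_rel `` {tuple5 1 u v s t}"
      using rel equiv_class_eq[OF equiv_proj_rel] z by metis
    then show "x \<in> ?\<phi> ` affine_points_off_hessian"
      using good by (intro image_eqI[of _ _ "(u, v, s, t)"]) simp_all
  qed
qed

section \<open>Cube roots and the norm form\<close>

lemma card_fibres:
  fixes P :: "'a::finite \<Rightarrow> 'b::finite \<Rightarrow> bool"
  shows "card {(x, y). P x y} = (\<Sum>x\<in>UNIV. card {y. P x y})"
proof -
  have "{(x, y). P x y} = Sigma UNIV (\<lambda>x. {y. P x y})" by auto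
  then show ?thesis by simp
qed

text \<open>This is the shape of fibre counts for an equation linear in one unknown: a generic size,
  a degenerate size, and otherwise the empty fibre.\<close>

lemma sum_if_if:
  fixes a b :: nat
  assumes "finite A"
  shows "(\<Sum>x\<in>A. if P x then a else if R x then b else 0) =
    a * card {x\<in>A. P x} + b * card {x\<in>A. \<not> P x \<and> R x}"
proof -
  have "(\<Sum>x\<in>A. if P x then a else if R x then b else 0) =
    (\<Sum>x\<in>A. (if P x then a else 0) + (if \<not> P x \<and> R x then b else 0))"
    by (intro sum.cong) auto
  also have "\<dots> = a * card {x\<in>A. P x} + b * card {x\<in>A. \<not> P x \<and> R x}"
    using assms by (simp add: sum.distrib sum.If_cases Int_def)
  finally show ?thesis .
qed

lemma card_linear_eq:
  fixes a c :: "'k::{field,finite}"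
  shows "card {x. x * a = c} = (if a \<noteq> 0 then 1 else if c = 0 then CARD('k) else 0)"
proof (cases "a = 0")
  case False
  then have "{x. x * a = c} = {c / a}" by (auto simp: field_simps)
  then show ?thesis using False by simp
qed auto

text \<open>The orbits of \<open>f\<close> partition \<open>A\<close> into sets of size 3.\<close>

lemma three_dvd_card_of_free_order3:
  assumes "finite A" "\<And>x. x \<in> A \<Longrightarrow> f x \<in> A" "\<And>x. x \<in> A \<Longrightarrow> f (f (f x)) = x"
    "\<And>x. x \<in> A \<Longrightarrow> f x \<noteq> x"
  shows "3 dvd card A"
proof -
  define C where "C = (\<lambda>x. {x, f x, f (f x)}) ` A"
  have "\<Union>C = A" using assms(2) by (auto simp: C_def)
  moreover have "3 * card C = card (\<Union>C)"
  proof (rule card_partition)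
    show "finite C" "finite (\<Union>C)" using assms by (auto simp: C_def)
    show "card c = 3" if c: "c \<in> C" for c
    proof -
      obtain x where x: "x \<in> A" "c = {x, f x, f (f x)}" using c by (auto simp: C_def)
      \<comment> \<open>If \<open>f (f x) = x\<close>, applying \<open>f\<close> would give
        \<open>x = f x\<close>.\<close>
      then have "f x \<noteq> x" "f (f x) \<noteq> f x" "f (f x) \<noteq> x"
        using assms(2-4) by metis+
      then show ?thesis using x by (auto simp: card_insert_if)
    qed
    show "c1 \<inter> c2 = {}" if c: "c1 \<in> C" "c2 \<in> C" "c1 \<noteq> c2" for c1 c2
    proof (rule ccontr)
      \<comment> \<open>Each orbit is generated by any of its elements, so orbits that meet
        coincide.\<close>
      have orbit: "c = {y, f y, f (f y)}" if "c \<in> C" "y \<in> c" for c y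
        using that assms(3) by (auto simp: C_def)
      assume "c1 \<inter> c2 \<noteq> {}"
      then obtain y where "y \<in> c1" "y \<in> c2" by blast
      then show False using orbit c by metis
    qed
  qed
  ultimately show ?thesis by (metis dvd_triv_left)
qed

section \<open>Cube roots of 1 and of -1\<close>

definition primitive_cube_roots :: "'k::comm_ring_1 set"
  where "primitive_cube_roots = {e. e\<^sup>2 + e + 1 = 0}"

definition cube_roots_minus_1 :: "'k::comm_ring_1 set"
  where "cube_roots_minus_1 = {x. x ^ 3 = -1}"

lemma cube_minus_1_factor: "(e::'a::comm_ring_1) ^ 3 - 1 = (e - 1) * (e\<^sup>2 + e + 1)"
  by (simp add: algebra_simps power_numeral_reduce)

lemma primitive_cube_root_cube:
  "e \<in> primitive_cube_roots \<Longrightarrow> e ^ 3 = (1 :: 'a::comm_ring_1)"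
  using cube_minus_1_factor[of e] by (simp add: primitive_cube_roots_def)

lemma one_notin_primitive_cube_roots:
  "(3::'k::field) \<noteq> 0 \<Longrightarrow> (1::'k) \<notin> primitive_cube_roots"
  by (simp add: primitive_cube_roots_def)

text \<open>Negation exchanges cube roots of -1 and of 1, and the latter are the zeros of
  \<open>(e - 1) * (e^2 + e + 1)\<close>.\<close>

lemma cube_roots_minus_1_eq:
  "cube_roots_minus_1 = uminus ` insert (1::'k::field) primitive_cube_roots"
proof -
  have "x ^ 3 = -1 \<longleftrightarrow> - x = 1 \<or> - x \<in> primitive_cube_roots" for x :: 'k
  proof -
    have "(- x) ^ 3 - 1 = (- x - 1) * ((- x)\<^sup>2 + - x + 1)" by (rule cube_minus_1_factor)
    moreover have "x ^ 3 = -1 \<longleftrightarrow> (- x) ^ 3 - 1 = 0"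
      by (metis (no_types, opaque_lifting) add.inverse_inverse eq_iff_diff_eq_0 power_minus_odd odd_numeral)
    ultimately show ?thesis by (simp add: primitive_cube_roots_def)
  qed
  then have "cube_roots_minus_1 = {x :: 'k. - x \<in> insert 1 primitive_cube_roots}"
    by (simp add: cube_roots_minus_1_def)
  also have "\<dots> = uminus ` insert 1 primitive_cube_roots"
  proof (intro equalityI subsetI)
    fix x :: 'k assume "x \<in> {x. - x \<in> insert 1 primitive_cube_roots}"
    then show "x \<in> uminus ` insert 1 primitive_cube_roots"
      by (intro image_eqI[of _ _ "- x"]) simp_all
  qed auto
  finally show ?thesis .
qed

lemma card_cube_roots_minus_1:
  assumes "(3::'k::{field,finite}) \<noteq> 0"
  shows "card (cube_roots_minus_1 :: 'k set) = 1 + card (primitive_cube_roots :: 'k set)"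
proof -
  have "card (cube_roots_minus_1 :: 'k set) = card (insert (1::'k) primitive_cube_roots)"
    unfolding cube_roots_minus_1_eq by (rule card_image) (auto simp: inj_on_def)
  then show ?thesis using one_notin_primitive_cube_roots[OF assms] by simp
qed

text \<open>Without such a root, a free map of order 3 on the field minus 0 and 1 gives 3 dividing q
  - 2. With a root \<open>w\<close>, multiplication by \<open>w\<close> is free of order 3 on the
  units, so 3 divides q - 1, and the quadratic has two distinct roots.\<close>

lemma card_primitive_cube_roots:
  assumes three: "(3::'k::{field,finite}) \<noteq> 0"
  shows "card (primitive_cube_roots :: 'k set) = (if CARD('k) mod 3 = 1 then 2 else 0)"
proof (cases "primitive_cube_roots = ({} :: 'k set)")
  case True
  text \<open>The order-3 map \<open>x \<mapsto> 1 / (1 - x)\<close> fixes exactly the negatives of these roots.\<close>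
  have "3 dvd card (UNIV - {0, 1 :: 'k})"
  proof (rule three_dvd_card_of_free_order3[where f = "\<lambda>x. 1 / (1 - x)"])
    fix x :: 'k assume "x \<in> UNIV - {0, 1}"
    then have x: "x \<noteq> 0" "1 - x \<noteq> 0" by auto
    have d: "1 - 1 / (1 - x) = - x / (1 - x)" using x by (simp add: field_simps)
    show "1 / (1 - x) \<in> UNIV - {0, 1}" using x by (auto simp: field_simps)
    show "1 / (1 - 1 / (1 - 1 / (1 - x))) = x"
      unfolding d using x by (simp add: field_simps)
    show "1 / (1 - x) \<noteq> x"
    proof
      assume "1 / (1 - x) = x"
      then have "(- x)\<^sup>2 + - x + 1 = 0" using x by (simp add: field_simps power2_eq_square)
      then have "- x \<in> primitive_cube_roots" by (simp only: primitive_cube_roots_def mem_Collect_eq)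
      then show False using True by simp
    qed
  qed simp
  then have "3 dvd CARD('k) - 2" by (simp add: card_Diff_subset numeral_2_eq_2)
  moreover have "CARD('k) \<ge> 2"
    using card_mono[of UNIV "{0, 1 :: 'k}"] by simp
  ultimately have "CARD('k) mod 3 \<noteq> 1" by presburger
  then show ?thesis using True by simp
next
  case False
  then obtain w :: 'k where w: "w \<in> primitive_cube_roots" by blast
  have w1: "w \<noteq> 1" using w one_notin_primitive_cube_roots[OF three] by blast
  have w3: "w ^ 3 = 1" by (rule primitive_cube_root_cube[OF w])
  have w0: "w \<noteq> 0" using w3 by auto
  have "3 dvd card (UNIV - {0 :: 'k})"
    by (rule three_dvd_card_of_free_order3[where f = "\<lambda>x. w * x"])
       (use w0 w1 w3 in \<open>auto simp: power3_eq_cube mult.assoc\<close>)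
  then have "3 dvd CARD('k) - 1" by simp
  moreover have "CARD('k) \<ge> 1" by (simp add: Suc_le_eq)
  ultimately have q: "CARD('k) mod 3 = 1" by presburger
  \<comment> \<open>The two roots have sum -1, which gives the second one.\<close>
  have "e\<^sup>2 + e + 1 = (e - w) * (e - (- 1 - w))" for e
  proof -
    have "e\<^sup>2 + e + 1 = (e - w) * (e - (- 1 - w)) + (w\<^sup>2 + w + 1)"
      by (simp add: algebra_simps power2_eq_square)
    moreover have "w\<^sup>2 + w + 1 = 0" using w by (simp add: primitive_cube_roots_def)
    ultimately show ?thesis by (simp only: add_0_right)
  qed
  then have eq: "primitive_cube_roots = {w, - 1 - w}"
    unfolding primitive_cube_roots_def by (simp only: mult_eq_0_iff right_minus_eq) auto
  have "w \<noteq> - 1 - w"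
  proof
    assume "w = - 1 - w"
    then have "2 * w + 1 = 0" by (simp add: algebra_simps eq_neg_iff_add_eq_0)
    \<comment> \<open>The left-hand side is identically 3, so a double root would make 3
      vanish.\<close>
    then have "4 * (w\<^sup>2 + w + 1) - (2 * w + 1)\<^sup>2 = 0"
      using w by (simp add: primitive_cube_roots_def)
    then show False using three by (simp add: algebra_simps power2_eq_square)
  qed
  then have "card (primitive_cube_roots :: 'k set) = 2"
    unfolding eq card_2_iff by blast
  then show ?thesis using q by simp
qed

section \<open>The norm form, its level sets and its zeros\<close>

definition norm3 :: "'a::comm_ring_1 \<Rightarrow> 'a \<Rightarrow> 'a \<Rightarrow> 'a"
  where "norm3 x y z = x ^ 3 + y ^ 3 + z ^ 3 - 3 * x * y * z"

text \<open>This is the norm of \<open>g - h X\<close> in \<open>k[X]/(X^2 + X + 1)\<close>.\<close>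

definition quad :: "'a::comm_ring_1 \<Rightarrow> 'a \<Rightarrow> 'a"
  where "quad g h = g\<^sup>2 + g * h + h\<^sup>2"

text \<open>
  Up to a linear change of coordinates (invertible as 3 is a unit), \<open>norm3\<close> is the product of a
  free linear coordinate \<open>p\<close> and the form \<open>quad\<close> in the two others, so on \<open>norm3 = k \<noteq> 0\<close> the
  coordinate \<open>p\<close> is determined.
\<close>

lemma norm3_factor: "norm3 x y z = (x + y + z) * quad (x - y) (y - z)"
  by (simp add: norm3_def quad_def algebra_simps power_numeral_reduce)

abbreviation mu :: "'k::{field,finite} itself \<Rightarrow> nat"
  where "mu _ \<equiv> card (cube_roots_minus_1 :: 'k set)"

text \<open>The pairs with nonzero \<open>quad\<close> are the units of
  \<open>k[X]/(X^2 + X + 1)\<close>, the points of a two-dimensional torus.\<close>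

definition torus_card :: "'k::{field,finite} itself \<Rightarrow> nat"
  where "torus_card _ = card {(g :: 'k, h). quad g h \<noteq> 0}"

definition norm3_zeros :: "'k::{field,finite} itself \<Rightarrow> nat"
  where "norm3_zeros _ = card {(x :: 'k, y, z). norm3 x y z = 0}"

definition norm3_affine_zeros :: "'k::{field,finite} itself \<Rightarrow> nat"
  where "norm3_affine_zeros _ = card {(y :: 'k, z). norm3 1 y z = 0}"

lemma quad_eq_0_iff:
  "quad g h = 0 \<longleftrightarrow> (g = 0 \<and> h = 0) \<or> (h \<noteq> 0 \<and> g / h \<in> primitive_cube_roots)"
  for g h :: "'k::field"
proof (cases "h = 0")
  case False
  then have "quad g h = h\<^sup>2 * ((g / h)\<^sup>2 + g / h + 1)"
    by (simp add: quad_def field_simps power2_eq_square)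
  then show ?thesis using False by (simp add: primitive_cube_roots_def)
qed (simp add: quad_def)

text \<open>The zero locus is a union of lines \<open>g = e * h\<close>, one for each primitive cube
  root \<open>e\<close>, meeting only in the origin, together with the origin itself.\<close>

lemma card_quad_eq_0:
  "card {(g :: 'k::{field,finite}, h). quad g h = 0} =
    1 + (CARD('k) - 1) * card (primitive_cube_roots :: 'k set)"
proof -
  let ?R = "primitive_cube_roots :: 'k set"
  let ?f = "\<lambda>(h, e). (e * h, h :: 'k)"
  have "{(g :: 'k, h). quad g h = 0} = insert (0, 0) (?f ` ((UNIV - {0}) \<times> ?R))"
  proof (intro equalityI subsetI)
    fix p assume "p \<in> {(g :: 'k, h). quad g h = 0}"
    then obtain g h where p: "p = (g, h)" "quad g h = 0" by auto
    then consider "p = (0, 0)" | "h \<noteq> 0" "g / h \<in> ?R" by (auto simp: quad_eq_0_iff)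
    then show "p \<in> insert (0, 0) (?f ` ((UNIV - {0}) \<times> ?R))"
    proof cases
      case 2
      then show ?thesis using p by (intro insertI2 image_eqI[of _ _ "(h, g / h)"]) auto
    qed simp
  qed (auto simp: quad_eq_0_iff)
  moreover have "(0, 0) \<notin> ?f ` ((UNIV - {0}) \<times> ?R)" by auto
  moreover have "inj_on ?f ((UNIV - {0}) \<times> ?R)" by (auto simp: inj_on_def)
  ultimately show ?thesis by (simp add: card_image card_cartesian_product)
qed

lemma torus_card_eq:
  "int (torus_card TYPE('k::{field,finite})) =
    (int CARD('k))\<^sup>2 - 1 - (int CARD('k) - 1) * int (card (primitive_cube_roots :: 'k set))"
proof -
  have "{(g :: 'k, h). quad g h \<noteq> 0} = UNIV - {(g, h). quad g h = 0}" by auto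
  then have "torus_card TYPE('k) = CARD('k \<times> 'k) - card {(g :: 'k, h). quad g h = 0}"
    by (simp add: torus_card_def card_Diff_subset)
  moreover have "card {(g :: 'k, h). quad g h = 0} \<le> CARD('k \<times> 'k)"
    by (rule card_mono) auto
  moreover have "CARD('k) \<ge> 1" by (simp add: Suc_le_eq)
  ultimately show ?thesis
    by (simp add: of_nat_diff card_quad_eq_0 power2_eq_square)
qed

text \<open>A pair \<open>(x - y, y - z)\<close> with nonzero \<open>quad\<close> fixes the linear
  factor \<open>x + y + z\<close>, and these three values recover the triple.\<close>

lemma card_norm3_eq:
  fixes k :: "'k::{field,finite}"
  assumes three: "(3::'k) \<noteq> 0" and "k \<noteq> 0"
  shows "card {(x, y, z). norm3 x y z = k} = torus_card TYPE('k)"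
  unfolding torus_card_def
proof (rule bij_betw_same_card, rule bij_betw_byWitness)
  let ?f = "\<lambda>(x, y, z). (x - y, y - z) :: 'k \<times> 'k"
  \<comment> \<open>With \<open>x = y + g\<close> and \<open>z = y - h\<close> the coordinate sum is
    \<open>3 * y + g - h\<close>; this is solved for \<open>y\<close>.\<close>
  let ?g = "\<lambda>(g, h). let y = (k / quad g h - g + h) / 3 in (y + g, y, y - h)"
  show "\<forall>p\<in>{(x, y, z). norm3 x y z = k}. ?g (?f p) = p"
  proof -
    have "k / quad (x - y) (y - z) = x + y + z" if n: "norm3 x y z = k" for x y z
    proof -
      have "quad (x - y) (y - z) \<noteq> 0" using n \<open>k \<noteq> 0\<close> by (auto simp: norm3_factor)
      then show ?thesis using n by (simp add: norm3_factor field_simps)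
    qed
    moreover have "(x + y + z - (x - y) + (y - z)) / 3 = y" for x y z :: 'k
      using three by (simp add: field_simps)
    ultimately show ?thesis by (auto simp: Let_def)
  qed
  show "\<forall>p\<in>{(g, h). quad g h \<noteq> 0}. ?f (?g p) = p" by (auto simp: Let_def)
  show "?f ` {(x, y, z). norm3 x y z = k} \<subseteq> {(g, h). quad g h \<noteq> 0}"
    using \<open>k \<noteq> 0\<close> by (auto simp: norm3_factor)
  show "?g ` {(g, h). quad g h \<noteq> 0} \<subseteq> {(x, y, z). norm3 x y z = k}"
  proof -
    have "norm3 (y + g) y (y - h) = k"
      if q: "quad g h \<noteq> 0" and y: "y = (k / quad g h - g + h) / 3" for g h y :: 'k
    proof -
      have "y + g + y + (y - h) = 3 * y + g - h" by simp
      also have "3 * y = k / quad g h - g + h" using three by (simp add: y)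
      finally have "y + g + y + (y - h) = k / quad g h" by simp
      then show ?thesis using q by (simp add: norm3_factor)
    qed
    then show ?thesis by (auto simp: Let_def)
  qed
qed

text \<open>All q^3 triples are sorted by their norm; each of the q - 1 nonzero values is taken
  equally often.\<close>

lemma norm3_zeros_eq:
  assumes three: "(3::'k::{field,finite}) \<noteq> 0"
  shows "int (norm3_zeros TYPE('k)) =
    int CARD('k) ^ 3 - (int CARD('k) - 1) * int (torus_card TYPE('k))"
proof -
  have "CARD('k) ^ 3 = card {(k :: 'k, p). (case p of (x, y, z) \<Rightarrow> norm3 x y z = k)}"
  proof -
    have "bij_betw (\<lambda>(x, y, z). (norm3 x y z, (x, y, z))) UNIV
      {(k :: 'k, p). (case p of (x, y, z) \<Rightarrow> norm3 x y z = k)}"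
      by (rule bij_betw_imageI) (auto simp: inj_on_def image_iff)
    then show ?thesis
      by (auto dest!: bij_betw_same_card simp: power3_eq_cube)
  qed
  also have "\<dots> = (\<Sum>k\<in>UNIV. card {(x, y, z). norm3 x y z = (k::'k)})"
    by (subst card_fibres) simp
  also have "\<dots> = norm3_zeros TYPE('k) + (\<Sum>k\<in>UNIV - {0::'k}. torus_card TYPE('k))"
    by (subst sum.remove[of _ 0]) (simp_all add: norm3_zeros_def card_norm3_eq[OF three])
  finally have "CARD('k) ^ 3 = norm3_zeros TYPE('k) + (CARD('k) - 1) * torus_card TYPE('k)"
    by simp
  moreover have "CARD('k) \<ge> 1" by (simp add: Suc_le_eq)
  ultimately show ?thesis by (metis (no_types, lifting) add_diff_cancel_right' of_nat_1 of_nat_add of_nat_diff of_nat_mult of_nat_power)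
qed

lemma card_cube_eq_minus_cube:
  fixes a :: "'k::{field,finite}"
  assumes "a \<noteq> 0"
  shows "card {x. x ^ 3 = - (a ^ 3)} = mu TYPE('k)"
proof -
  have "bij_betw (\<lambda>x. a * x) cube_roots_minus_1 {x. x ^ 3 = - (a ^ 3)}"
    by (rule bij_betw_byWitness[where f' = "\<lambda>x. x / a"])
       (use assms in \<open>auto simp: cube_roots_minus_1_def power_mult_distrib power_divide\<close>)
  then show ?thesis by (simp add: bij_betw_same_card)
qed

lemma norm3_scale: "norm3 (c * x) (c * y) (c * z) = c ^ 3 * norm3 x y z"
  by (simp add: norm3_def algebra_simps power_numeral_reduce)

text \<open>A second count of the same zeros, sliced by \<open>x\<close>: slices with
  \<open>x\<close> nonzero scale to \<open>x = 1\<close>, and \<open>x = 0\<close> leaves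
  \<open>y^3 + z^3 = 0\<close>. Comparison with the first count later yields
  \<open>norm3_affine_zeros\<close>.\<close>

lemma norm3_zeros_eq_affine:
  "int (norm3_zeros TYPE('k::{field,finite})) =
    1 + (int CARD('k) - 1) * (int (mu TYPE('k)) + int (norm3_affine_zeros TYPE('k)))"
proof -
  have q: "CARD('k) \<ge> 1" by (simp add: Suc_le_eq)
  have 0: "card {(y :: 'k, z). norm3 0 y z = 0} = 1 + (CARD('k) - 1) * mu TYPE('k)"
  proof -
    have "card {(y :: 'k, z). norm3 0 y z = 0} = (\<Sum>y\<in>UNIV. card {z :: 'k. norm3 0 y z = 0})"
      by (rule card_fibres)
    also have "\<dots> = (\<Sum>y\<in>UNIV. card {z :: 'k. z ^ 3 = - (y ^ 3)})"
      by (simp add: norm3_def eq_neg_iff_add_eq_0 add.commute)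
    also have "\<dots> = card {z :: 'k. z ^ 3 = - (0 ^ 3)} + (\<Sum>y\<in>UNIV - {0::'k}. mu TYPE('k))"
      by (subst sum.remove[of _ 0]) (simp_all add: card_cube_eq_minus_cube)
    finally show ?thesis by simp
  qed
  have 1: "card {(y, z). norm3 x y z = 0} = norm3_affine_zeros TYPE('k)" if "x \<noteq> 0" for x :: 'k
    unfolding norm3_affine_zeros_def
  proof (rule bij_betw_same_card[OF bij_betw_byWitness[where f = "\<lambda>(y, z). (y / x, z / x)"
        and f' = "\<lambda>(y, z). (x * y, x * z)"]])
    show "(\<lambda>(y, z). (y / x, z / x)) ` {(y, z). norm3 x y z = 0} \<subseteq> {(y, z). norm3 1 y z = 0}"
      using norm3_scale[of "1 / x" x] that by auto
    show "(\<lambda>(y, z). (x * y, x * z)) ` {(y, z). norm3 1 y z = 0} \<subseteq> {(y, z). norm3 x y z = 0}"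
      using norm3_scale[of x 1] by auto
  qed (use that in auto)
  have "norm3_zeros TYPE('k) = (\<Sum>x\<in>UNIV. card {(y :: 'k, z). norm3 x y z = 0})"
    unfolding norm3_zeros_def
    by (subst card_fibres[of "\<lambda>x (y, z). norm3 x y z = 0", symmetric]) (simp add: case_prod_unfold)
  also have "\<dots> = 1 + (CARD('k) - 1) * mu TYPE('k) + (CARD('k) - 1) * norm3_affine_zeros TYPE('k)"
    by (subst sum.remove[of _ 0]) (simp_all add: 0 1)
  finally have "norm3_zeros TYPE('k) =
    1 + (CARD('k) - 1) * (mu TYPE('k) + norm3_affine_zeros TYPE('k))"
    by (simp add: algebra_simps)
  then show ?thesis using q by (simp add: of_nat_diff)
qed

section \<open>Points of the cubic threefold\<close>

lemma zero_notin_cube_roots_minus_1 [simp]: "(0::'k::field) \<notin> cube_roots_minus_1"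
  by (simp add: cube_roots_minus_1_def)

text \<open>The term \<open>3 * u * v * s * t\<close> is the mixed term of the norm at third entry
  \<open>- (s * t)\<close>, whose cube cancels the cross term of the product.\<close>

lemma quartic_explicit_1:
  "quartic_explicit 1 u v s t = norm3 u v (- (s * t)) + (1 + s ^ 3) * (1 + t ^ 3)"
  by (simp add: quartic_explicit_def norm3_def algebra_simps power_numeral_reduce)

text \<open>Each slice with fixed \<open>s\<close> is a level set of the norm form.\<close>

definition cubic_points :: "('k::comm_ring_1 \<times> 'k \<times> 'k \<times> 'k) set"
  where "cubic_points = {(s, x, y, z). norm3 x y z = - (1 + s ^ 3)}"

lemma card_compl_cube_roots_minus_1:
  "int (card (- (cube_roots_minus_1 :: 'k::{field,finite} set))) = int CARD('k) - int (mu TYPE('k))"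
  by (simp add: Compl_eq_Diff_UNIV card_Diff_subset of_nat_diff card_mono)

lemma neg_one_plus_cube_eq_0_iff: "- (1 + s ^ 3) = (0 :: 'k::comm_ring_1) \<longleftrightarrow> s \<in> cube_roots_minus_1"
  by (simp add: cube_roots_minus_1_def cube_eq_minus_1_iff del: minus_add_distrib)

lemma card_cubic_points:
  assumes three: "(3::'k::{field,finite}) \<noteq> 0"
  shows "int (card (cubic_points :: ('k \<times> 'k \<times> 'k \<times> 'k) set)) =
    (int CARD('k) - int (mu TYPE('k))) * int (torus_card TYPE('k))
    + int (mu TYPE('k)) * int (norm3_zeros TYPE('k))"
proof -
  let ?M = "cube_roots_minus_1 :: 'k set"
  have "card (cubic_points :: ('k \<times> 'k \<times> 'k \<times> 'k) set) =
    (\<Sum>s\<in>UNIV. card {(x, y, z). norm3 x y z = - (1 + (s::'k) ^ 3)})"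
    unfolding cubic_points_def
    by (subst card_fibres[symmetric]) simp
  also have "\<dots> = (\<Sum>s\<in>UNIV. if s \<in> ?M then norm3_zeros TYPE('k) else torus_card TYPE('k))"
  proof (rule sum.cong[OF refl])
    fix s :: 'k
    show "card {(x, y, z). norm3 x y z = - (1 + s ^ 3)} =
      (if s \<in> ?M then norm3_zeros TYPE('k) else torus_card TYPE('k))"
      using neg_one_plus_cube_eq_0_iff[of s] card_norm3_eq[OF three, of "- (1 + s ^ 3)"]
      by (auto simp: norm3_zeros_def)
  qed
  also have "\<dots> = card ?M * norm3_zeros TYPE('k) + card (- ?M) * torus_card TYPE('k)"
    by (simp add: sum.If_cases)
  finally show ?thesis by (simp add: card_compl_cube_roots_minus_1)
qed

text \<open>For \<open>y = - s\<close> the cubes of \<open>y\<close> and \<open>s\<close> cancel,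
  leaving an equation linear in \<open>s\<close>.\<close>

lemma cubic_points_opposite_iff:
  "(s, x, y, z) \<in> cubic_points \<and> y + s = 0 \<longleftrightarrow>
    y = - s \<and> s * (3 * x * z) = - (1 + x ^ 3 + z ^ 3)"
proof -
  have "norm3 x (- s) z = - (1 + s ^ 3) \<longleftrightarrow> s * (3 * x * z) = - (1 + x ^ 3 + z ^ 3)"
  proof -
    have "norm3 x (- s) z + (1 + s ^ 3) = s * (3 * x * z) + (1 + x ^ 3 + z ^ 3)"
      by (simp add: norm3_def algebra_simps)
    then show ?thesis unfolding eq_neg_iff_add_eq_0 by (simp only:)
  qed
  moreover have "y + s = 0 \<longleftrightarrow> y = - s" by (simp add: eq_neg_iff_add_eq_0)
  ultimately show ?thesis by (auto simp: cubic_points_def simp del: minus_add_distrib)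
qed

text \<open>If \<open>x\<close> and \<open>z\<close> are nonzero, \<open>s\<close> is determined.
  Otherwise \<open>1 + x^3 + z^3 = 0\<close> is needed, so one of them is 0 and the other a cube
  root of -1, and \<open>s\<close> is free.\<close>

lemma card_cubic_points_opposite:
  assumes three: "(3::'k::{field,finite}) \<noteq> 0"
  shows "card {(s, x, y, z). (s, x, y, z) \<in> cubic_points \<and> y + s = (0::'k)} =
    (CARD('k) - 1)\<^sup>2 + CARD('k) * (2 * mu TYPE('k))"
proof -
  let ?M = "cube_roots_minus_1 :: 'k set"
  have "bij_betw (\<lambda>((x, z), s). (s, x, - s, z))
    {(p, s). s * (3 * fst p * snd p) = - (1 + fst p ^ 3 + snd p ^ 3)}
    {(s, x, y, z). (s, x, y, z) \<in> cubic_points \<and> y + s = (0::'k)}"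
    unfolding cubic_points_opposite_iff
    by (rule bij_betw_byWitness[where f' = "\<lambda>(s, x, y, z). ((x, z), s)"]) auto
  then have "card {(s, x, y, z). (s, x, y, z) \<in> cubic_points \<and> y + s = (0::'k)} =
    card {(p :: 'k \<times> 'k, s). s * (3 * fst p * snd p) = - (1 + fst p ^ 3 + snd p ^ 3)}"
    by (simp add: bij_betw_same_card)
  also have "\<dots> = 1 * card {p :: 'k \<times> 'k. p \<in> UNIV \<and> 3 * fst p * snd p \<noteq> 0}
    + CARD('k) * card {p :: 'k \<times> 'k. p \<in> UNIV \<and> \<not> 3 * fst p * snd p \<noteq> 0 \<and> - (1 + fst p ^ 3 + snd p ^ 3) = 0}"
    unfolding card_fibres card_linear_eq by (rule sum_if_if) simp
  also have "{p :: 'k \<times> 'k. p \<in> UNIV \<and> 3 * fst p * snd p \<noteq> 0} = (UNIV - {0}) \<times> (UNIV - {0})"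
    using three by auto
  also have "{p :: 'k \<times> 'k. p \<in> UNIV \<and> \<not> 3 * fst p * snd p \<noteq> 0 \<and> - (1 + fst p ^ 3 + snd p ^ 3) = 0} =
    {0} \<times> ?M \<union> ?M \<times> {0}"
    using three by (auto simp: cube_roots_minus_1_def cube_eq_minus_1_iff simp del: minus_add_distrib)
  also have "card ({0} \<times> ?M \<union> ?M \<times> {0}) = 2 * mu TYPE('k)"
    by (subst card_Un_disjoint) (auto simp: card_cartesian_product)
  finally show ?thesis by (simp add: card_cartesian_product power2_eq_square)
qed

lemma card_cubic_points_opposite_zero:
  "card {(s, x, y, z). (s, x, y, z) \<in> cubic_points \<and> y + s = (0::'k) \<and> z = 0} =
    CARD('k::{field,finite}) * mu TYPE('k)"
proof -
  have "bij_betw (\<lambda>(s, x). (s, x, - s, 0)) (UNIV \<times> (cube_roots_minus_1 :: 'k set))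
    {(s, x, y, z). (s, x, y, z) \<in> cubic_points \<and> y + s = 0 \<and> z = 0}"
    unfolding conj_assoc[symmetric] cubic_points_opposite_iff
    by (rule bij_betw_byWitness[where f' = "\<lambda>(s, x, y, z). (s, x)"])
      (auto simp: cube_roots_minus_1_def cube_eq_minus_1_iff simp del: minus_add_distrib)
  then show ?thesis by (auto dest!: bij_betw_same_card simp: card_cartesian_product)
qed

text \<open>Here \<open>y - z = - s\<close>, so the equation is linear in
  \<open>p = x + y + z\<close>, with coefficient \<open>quad (x - y) (- s)\<close>. Where it
  vanishes, \<open>s\<close> is a cube root of -1, \<open>(x - y) / (- s)\<close> is a primitive
  cube root of 1, and \<open>p\<close> is free.\<close>

lemma card_cubic_points_hyperplane:
  assumes three: "(3::'k::{field,finite}) \<noteq> 0"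
  shows "card {(s, x, y, z). (s, x, y, z) \<in> cubic_points \<and> z = y + (s::'k)} =
    torus_card TYPE('k) + CARD('k) * (mu TYPE('k) * card (primitive_cube_roots :: 'k set))"
proof -
  let ?M = "cube_roots_minus_1 :: 'k set" and ?R = "primitive_cube_roots :: 'k set"
  let ?f = "\<lambda>(s, x, y, z). ((x - y, s), x + y + z) :: ('k \<times> 'k) \<times> 'k"
  let ?g = "\<lambda>((g, s), p). let y = (p - g - s) / 3 in (s, y + g, y, y + s) :: 'k \<times> 'k \<times> 'k \<times> 'k"
  have "bij_betw ?f {(s, x, y, z). (s, x, y, z) \<in> cubic_points \<and> z = y + s}
     {(r, p). p * quad (fst r) (- snd r) = - (1 + snd r ^ 3)}"
  proof (rule bij_betw_byWitness[where f' = ?g])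
    have "(x + y + (y + s) - (x - y) - s) / 3 = y" for x y s :: 'k
      using three by (simp add: field_simps)
    then show "\<forall>c\<in>{(s, x, y, z). (s, x, y, z) \<in> cubic_points \<and> z = y + s}. ?g (?f c) = c"
      by (auto simp: Let_def)
    have sum: "y + g + y + (y + s) = p" if "y = (p - g - s) / 3" for y p g s :: 'k
    proof -
      have "y + g + y + (y + s) = 3 * y + g + s" by simp
      also have "3 * y = p - g - s" using three that by (simp add: mult.commute)
      finally show ?thesis by simp
    qed
    have "?f (?g ((g, s), p)) = ((g, s), p)" for g s p :: 'k
      unfolding Let_def prod.case sum[OF refl] by simp
    then show "\<forall>c\<in>{(r, p). p * quad (fst r) (- snd r) = - (1 + snd r ^ 3)}. ?f (?g c) = c"
      by (intro ballI) (simp only: split_paired_all)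
    show "?f ` {(s, x, y, z). (s, x, y, z) \<in> cubic_points \<and> z = y + s} \<subseteq>
        {(r, p). p * quad (fst r) (- snd r) = - (1 + snd r ^ 3)}"
      by (auto simp: cubic_points_def norm3_factor)
    have norm: "norm3 (y + g) y (y + s) = p * quad g (- s)" if "y = (p - g - s) / 3" for y p g s :: 'k
      using sum[OF that] by (simp add: norm3_factor)
    show "?g ` {(r, p). p * quad (fst r) (- snd r) = - (1 + snd r ^ 3)} \<subseteq>
        {(s, x, y, z). (s, x, y, z) \<in> cubic_points \<and> z = y + s}"
      by (auto simp: cubic_points_def Let_def norm[OF refl])
  qed
  then have "card {(s, x, y, z). (s, x, y, z) \<in> cubic_points \<and> z = y + (s::'k)} =
    card {(r :: 'k \<times> 'k, p). p * quad (fst r) (- snd r) = - (1 + snd r ^ 3)}"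
    by (rule bij_betw_same_card)
  also have "\<dots> = 1 * card {r :: 'k \<times> 'k. r \<in> UNIV \<and> quad (fst r) (- snd r) \<noteq> 0}
    + CARD('k) * card {r :: 'k \<times> 'k. r \<in> UNIV \<and> \<not> quad (fst r) (- snd r) \<noteq> 0 \<and> - (1 + snd r ^ 3) = 0}"
    unfolding card_fibres card_linear_eq by (rule sum_if_if) simp
  also have "card {r :: 'k \<times> 'k. r \<in> UNIV \<and> quad (fst r) (- snd r) \<noteq> 0} = torus_card TYPE('k)"
    unfolding torus_card_def
    by (rule bij_betw_same_card[OF bij_betw_byWitness[where f = "\<lambda>(g, s). (g, - s)"
          and f' = "\<lambda>(g, s). (g, - s)"]]) auto
  also have "card {r :: 'k \<times> 'k. r \<in> UNIV \<and> \<not> quad (fst r) (- snd r) \<noteq> 0 \<and> - (1 + snd r ^ 3) = 0} =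
    card (?M \<times> ?R)"
    unfolding neg_one_plus_cube_eq_0_iff
  proof (rule bij_betw_same_card[OF bij_betw_byWitness[where f = "\<lambda>(g, s). (s, g / (- s))"
          and f' = "\<lambda>(s, e). (- s * e, s)"]])
    show "(\<lambda>(s, e). (- s * e, s)) ` (?M \<times> ?R) \<subseteq>
        {r. r \<in> UNIV \<and> \<not> quad (fst r) (- snd r) \<noteq> 0 \<and> snd r \<in> ?M}"
      by (auto simp: quad_eq_0_iff split: if_splits)
  qed (auto simp: quad_eq_0_iff)
  finally show ?thesis by (simp add: card_cartesian_product)
qed

text \<open>
  The transformations \<open>(x, z) \<mapsto> (e\<^sup>2 x, - e z)\<close> with \<open>e\<^sup>3 = -1\<close> preserve the cubic and reduce
  \<open>z\<^sup>3 = (y + s)\<^sup>3\<close> to \<open>z = y + s\<close>.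
\<close>

lemma card_cubic_points_cone:
  assumes three: "(3::'k::{field,finite}) \<noteq> 0"
  shows "card {(s, x, y, z). (s, x, y, z) \<in> cubic_points \<and> y + s \<noteq> 0 \<and> z ^ 3 = (y + s :: 'k) ^ 3} =
    mu TYPE('k) * card {(s, x, y, z). (s, x, y, z) \<in> cubic_points \<and> z = y + (s::'k) \<and> z \<noteq> 0}"
proof -
  let ?M = "cube_roots_minus_1 :: 'k set"
  let ?A = "{(s, x, y, z). (s, x, y, z) \<in> cubic_points \<and> z = y + (s::'k) \<and> z \<noteq> 0}"
  let ?B = "{(s, x, y, z). (s, x, y, z) \<in> cubic_points \<and> y + s \<noteq> 0 \<and> z ^ 3 = (y + s :: 'k) ^ 3}"
  let ?f = "\<lambda>(e, s, x, y, z). (s, e\<^sup>2 * x, y, - e * z) :: 'k \<times> 'k \<times> 'k \<times> 'k"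
  let ?g = "\<lambda>(s, x, y, z). let e = - (z / (y + s)) in (e, s, x / e\<^sup>2, y, y + s) :: 'k \<times> 'k \<times> 'k \<times> 'k \<times> 'k"
  \<comment> \<open>The multipliers \<open>e^2\<close> and \<open>- e\<close> both have cube 1, and
    their product is 1.\<close>
  have norm: "norm3 (e\<^sup>2 * x) y (- e * z) = norm3 x y z" if e: "e ^ 3 = -1" for e x y z :: 'k
  proof -
    have "(e\<^sup>2 * x) ^ 3 = (e ^ 3)\<^sup>2 * x ^ 3" "(- e * z) ^ 3 = - (e ^ 3) * z ^ 3"
      "3 * (e\<^sup>2 * x) * y * (- e * z) = - (e ^ 3) * (3 * x * y * z)"
      by (simp_all add: algebra_simps power_numeral_reduce)
    then show ?thesis unfolding norm3_def e by simp
  qed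
  have "bij_betw ?f (?M \<times> ?A) ?B"
  proof (rule bij_betw_byWitness[where f' = ?g])
    show "\<forall>p\<in>?M \<times> ?A. ?g (?f p) = p"
      by (auto simp: Let_def cube_roots_minus_1_def)
    have e: "(- (z / (y + s))) ^ 3 = -1" "z \<noteq> 0" if "y + s \<noteq> 0" "z ^ 3 = (y + s) ^ 3" for y s z :: 'k
      using that by (auto simp: power_divide)
    then show "\<forall>p\<in>?B. ?f (?g p) = p"
      by (auto simp: Let_def)
    show "?f ` (?M \<times> ?A) \<subseteq> ?B"
      by (auto simp: cubic_points_def cube_roots_minus_1_def norm[simplified] power_mult_distrib)
    have "norm3 (x / e\<^sup>2) y w = norm3 x y z" if "e ^ 3 = -1" "z = - e * w" for e x y z w :: 'k
      using norm[OF that(1), of "x / e\<^sup>2" y w] that by (cases "e = 0") auto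
    then have "norm3 (x / (- (z / (y + s)))\<^sup>2) y (y + s) = norm3 x y z"
      if "y + s \<noteq> 0" "z ^ 3 = (y + s) ^ 3" for x y s z :: 'k
      using e[OF that] that by (metis minus_minus minus_mult_left nonzero_eq_divide_eq)
    then show "?g ` ?B \<subseteq> ?M \<times> ?A"
      using e by (auto simp: Let_def cubic_points_def cube_roots_minus_1_def)
  qed
  then show ?thesis by (auto dest!: bij_betw_same_card simp: card_cartesian_product)
qed

section \<open>Points of the quartic threefold\<close>

text \<open>
  \<open>norm3 x y z\<close> is the norm of \<open>x + y X + z X\<^sup>2\<close> in \<open>k[X]/(X\<^sup>3 - 1)\<close>; this is multiplication by \<open>1 + t X\<close>.
\<close>

lemma norm3_times_linear:
  "norm3 (x + t * z) (y + t * x) (z + t * y) = (1 + t ^ 3) * norm3 x y z"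
  by (simp add: norm3_def algebra_simps power_numeral_reduce)

section \<open>From the quartic to the cubic by division by \<open>1 + t X\<close>\<close>

text \<open>One set per coordinate allows each to be free, a cube root of -1 or not; integer values
  permit inclusion and exclusion by subtraction.\<close>

definition quartic_count :: "'k::{field,finite} set \<Rightarrow> 'k set \<Rightarrow> 'k set \<Rightarrow> 'k set \<Rightarrow> int"
  where "quartic_count A B C D = int (card {(u, v, s, t).
    quartic_explicit 1 u v s t = 0 \<and> u \<in> A \<and> v \<in> B \<and> s \<in> C \<and> t \<in> D})"

text \<open>As \<open>1 + t^3\<close> is nonzero, \<open>(u, v, - (s * t))\<close> is uniquely
  \<open>1 + t X\<close> times some \<open>(x, y, z)\<close>. Its last entry gives the condition on
  \<open>z\<close>, and cancelling \<open>1 + t^3\<close> gives the cubic.\<close>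

lemma quartic_count_eq_cubic:
  "quartic_count UNIV UNIV UNIV (- (cube_roots_minus_1 :: 'k set)) =
    int (card {(c, t). c \<in> cubic_points \<and> t \<notin> (cube_roots_minus_1 :: 'k::{field,finite} set) \<and>
      (case c of (s, x, y, z) \<Rightarrow> z = - t * (y + s))})"
proof -
  let ?M = "cube_roots_minus_1 :: 'k set"
  let ?f = "\<lambda>((s, x, y, z), t). (x + t * z, y + t * x, s, t) :: 'k \<times> 'k \<times> 'k \<times> 'k"
  \<comment> \<open>The inverse of \<open>1 + t X\<close> modulo \<open>X^3 - 1\<close> is
    \<open>(1 - t X + t^2 X^2) / (1 + t^3)\<close>.\<close>
  let ?g = "\<lambda>(u, v, s, t). ((s, (u + t\<^sup>2 * v + t * (s * t)) / (1 + t ^ 3),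
    (v - t * u - t\<^sup>2 * (s * t)) / (1 + t ^ 3), (t\<^sup>2 * u - t * v - s * t) / (1 + t ^ 3)), t) ::
    ('k \<times> 'k \<times> 'k \<times> 'k) \<times> 'k"
  let ?A = "{(c, t). c \<in> cubic_points \<and> t \<notin> ?M \<and> (case c of (s, x, y, z) \<Rightarrow> z = - t * (y + s))}"
  let ?B = "{(u, v, s, t). quartic_explicit 1 u v s t = 0 \<and> t \<notin> ?M}"
  have nz: "1 + t ^ 3 \<noteq> 0" if "t \<notin> ?M" for t
    using that by (simp add: cube_roots_minus_1_def cube_eq_minus_1_iff)
  have zt: "z + t * y = - (s * t)" if "z = - t * (y + s)" for s t y z :: 'k
    unfolding that by (simp add: algebra_simps)
  have fwd: "quartic_explicit 1 (x + t * z) (y + t * x) s t = (1 + t ^ 3) * (norm3 x y z + (1 + s ^ 3))"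
    if "z = - t * (y + s)" for s t x y z :: 'k
    unfolding quartic_explicit_1 zt[OF that, symmetric] norm3_times_linear
    by (simp add: algebra_simps)
  have fg: "x + t * z = u" "y + t * x = v" "z + t * y = - (s * t)"
    if "t \<notin> ?M" "?g (u, v, s, t) = ((s, x, y, z), t)" for u v s t x y z
  proof -
    have d: "1 + t ^ 3 \<noteq> 0" by (rule nz) fact
    have "x * (1 + t ^ 3) = u + t\<^sup>2 * v + t * (s * t)"
      "y * (1 + t ^ 3) = v - t * u - t\<^sup>2 * (s * t)"
      "z * (1 + t ^ 3) = t\<^sup>2 * u - t * v - s * t"
      using that(2) d by auto
    then have "(x + t * z) * (1 + t ^ 3) = u * (1 + t ^ 3)"
      "(y + t * x) * (1 + t ^ 3) = v * (1 + t ^ 3)"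
      "(z + t * y) * (1 + t ^ 3) = - (s * t) * (1 + t ^ 3)"
      unfolding distrib_right[of _ _ "1 + t ^ 3"] mult.assoc[of t _ "1 + t ^ 3"]
      by (simp_all only:) (simp_all add: algebra_simps power_numeral_reduce)
    then show "x + t * z = u" "y + t * x = v" "z + t * y = - (s * t)"
      using d by (simp_all only: mult_right_cancel[OF d])
  qed
  have "bij_betw ?f ?A ?B"
  proof (rule bij_betw_byWitness[where f' = ?g])
    show "\<forall>p\<in>?A. ?g (?f p) = p"
    proof
      fix p assume "p \<in> ?A"
      moreover obtain s x y z t where p: "p = ((s, x, y, z), t)" by (metis prod.exhaust)
      ultimately have "t \<notin> ?M" and "z = - t * (y + s)" by auto
      have d: "1 + t ^ 3 \<noteq> 0" by (rule nz) fact
      have w: "- (s * t) = z + t * y" using zt[OF \<open>z = _\<close>] by simp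
      have "x + t * z + t\<^sup>2 * (y + t * x) - t * (z + t * y) = (1 + t ^ 3) * x"
        "y + t * x - t * (x + t * z) + t\<^sup>2 * (z + t * y) = (1 + t ^ 3) * y"
        "t\<^sup>2 * (x + t * z) - t * (y + t * x) + (z + t * y) = (1 + t ^ 3) * z"
        by (simp_all add: algebra_simps power_numeral_reduce)
      then have "?g (?f ((s, x, y, z), t)) = ((s, x, y, z), t)"
        using d by (simp add: w[symmetric])
      then show "?g (?f p) = p" unfolding p .
    qed
    show "\<forall>p\<in>?B. ?f (?g p) = p"
    proof
      fix p assume "p \<in> ?B"
      moreover obtain u v s t where p: "p = (u, v, s, t)" by (metis prod_cases4)
      ultimately have "t \<notin> ?M" by auto
      obtain x y z where g: "?g (u, v, s, t) = ((s, x, y, z), t)" by simp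
      have "?f (?g (u, v, s, t)) = ?f ((s, x, y, z), t)" by (rule arg_cong[OF g])
      also have "\<dots> = (u, v, s, t)" using fg(1,2)[OF \<open>t \<notin> ?M\<close> g] by simp
      finally show "?f (?g p) = p" unfolding p .
    qed
    show "?f ` ?A \<subseteq> ?B"
    proof (rule image_subsetI)
      fix p assume "p \<in> ?A"
      moreover obtain s x y z t where p: "p = ((s, x, y, z), t)" by (metis prod.exhaust)
      ultimately have "norm3 x y z = - (1 + s ^ 3)" "z = - t * (y + s)" "t \<notin> ?M"
        by (auto simp: cubic_points_def)
      then show "?f p \<in> ?B" using fwd[OF \<open>z = _\<close>, of x] p by simp
    qed
    show "?g ` ?B \<subseteq> ?A"
    proof (rule image_subsetI)
      fix p assume "p \<in> ?B"
      moreover obtain u v s t where p: "p = (u, v, s, t)" by (metis prod_cases4)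
      ultimately have q: "quartic_explicit 1 u v s t = 0" and t: "t \<notin> ?M" by auto
      obtain x y z where g: "?g (u, v, s, t) = ((s, x, y, z), t)" by simp
      note eqs = fg[OF t g]
      have z: "z = - t * (y + s)" using eqs(3) by (simp add: algebra_simps eq_neg_iff_add_eq_0)
      have "(1 + t ^ 3) * (norm3 x y z + (1 + s ^ 3)) = 0"
        using fwd[OF z, of x] q unfolding eqs(1,2) by simp
      then have "norm3 x y z = - (1 + s ^ 3)"
        using nz[OF t] by (simp add: eq_neg_iff_add_eq_0 del: minus_add_distrib)
      then show "?g p \<in> ?A"
        unfolding p g using z t by (simp add: cubic_points_def)
    qed
  qed
  then have "card ?A = card ?B" by (rule bij_betw_same_card)
  then show ?thesis by (simp add: quartic_count_def)
qed

text \<open>If \<open>y + s\<close> is nonzero, the only candidate is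
  \<open>t = - (z / (y + s))\<close>, excluded exactly when \<open>z^3 = (y + s)^3\<close>.
  Otherwise \<open>z = 0\<close> is needed and \<open>t\<close> is unconstrained by the
  equation.\<close>

lemma card_fibre_over_cubic:
  fixes s y z :: "'k::{field,finite}"
  shows "card {t. t \<notin> cube_roots_minus_1 \<and> z = - t * (y + s)} =
    (if y + s \<noteq> 0 \<and> z ^ 3 \<noteq> (y + s) ^ 3 then 1
     else if y + s = 0 \<and> z = 0 then card (- (cube_roots_minus_1 :: 'k set)) else 0)"
proof (cases "y + s = 0")
  case True
  then show ?thesis by (auto simp: Compl_eq)
next
  case False
  have "z = - t * (y + s) \<longleftrightarrow> t = - (z / (y + s))" for t
    using False by (auto simp: field_simps eq_neg_iff_add_eq_0)
  then have "{t. t \<notin> cube_roots_minus_1 \<and> z = - t * (y + s)} =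
    (if - (z / (y + s)) \<in> cube_roots_minus_1 then {} else {- (z / (y + s))})"
    by auto
  moreover have "- (z / (y + s)) \<in> cube_roots_minus_1 \<longleftrightarrow> z ^ 3 = (y + s) ^ 3"
    using False by (simp add: cube_roots_minus_1_def power_divide)
  ultimately show ?thesis using False by simp
qed

text \<open>Fibre sizes are summed over the cubic: the generic part \<open>?A2\<close> is what
  remains after removing \<open>?A0\<close> and \<open>?A1\<close>, and each point of
  \<open>?Z\<close> contributes \<open>q - m\<close>.\<close>

lemma quartic_count_good_last:
  assumes three: "(3::'k::{field,finite}) \<noteq> 0"
  defines "q \<equiv> int CARD('k)" and "m \<equiv> int (mu TYPE('k))" and "T \<equiv> int (torus_card TYPE('k))"
    and "r \<equiv> int (card (primitive_cube_roots :: 'k set))" and "n \<equiv> int (norm3_zeros TYPE('k))"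
  shows "quartic_count UNIV UNIV UNIV (- (cube_roots_minus_1 :: 'k set)) =
    (q - m) * T + m * n - (q - 1)\<^sup>2 - 2 * m * q - m * (T + q * m * r - q * m) + (q - m) * (q * m)"
proof -
  let ?M = "cube_roots_minus_1 :: 'k set" and ?C = "cubic_points :: ('k \<times> 'k \<times> 'k \<times> 'k) set"
  let ?A0 = "{(s, x, y, z). (s, x, y, z) \<in> ?C \<and> y + s = 0}"
  let ?A1 = "{(s, x, y, z). (s, x, y, z) \<in> ?C \<and> y + s \<noteq> 0 \<and> z ^ 3 = (y + s) ^ 3}"
  let ?A2 = "{(s, x, y, z). (s, x, y, z) \<in> ?C \<and> y + s \<noteq> 0 \<and> z ^ 3 \<noteq> (y + s) ^ 3}"
  let ?Z = "{(s, x, y, z). (s, x, y, z) \<in> ?C \<and> y + s = 0 \<and> z = 0}"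
  let ?H = "{(s, x, y, z). (s, x, y, z) \<in> ?C \<and> z = y + s}"
  let ?H' = "{(s, x, y, z). (s, x, y, z) \<in> ?C \<and> z = y + s \<and> z \<noteq> 0}"
  define P R where "P = (\<lambda>(s :: 'k, x :: 'k, y, z :: 'k). y + s \<noteq> 0 \<and> z ^ 3 \<noteq> (y + s) ^ 3)"
    and "R = (\<lambda>(s :: 'k, x :: 'k, y, z :: 'k). y + s = 0 \<and> z = 0)"
  have "card {(c, t). c \<in> ?C \<and> t \<notin> ?M \<and> (case c of (s, x, y, z) \<Rightarrow> z = - t * (y + s))} =
    card (SIGMA c : ?C. {t. t \<notin> ?M \<and> (case c of (s, x, y, z) \<Rightarrow> z = - t * (y + s))})"
    by (rule arg_cong[of _ _ card]) auto
  also have "\<dots> = (\<Sum>c\<in>?C. card {t. t \<notin> ?M \<and> (case c of (s, x, y, z) \<Rightarrow> z = - t * (y + s))})"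
    by simp
  also have "\<dots> = (\<Sum>c\<in>?C. if P c then 1 else if R c then card (- ?M) else 0)"
  proof (rule sum.cong[OF refl])
    fix c :: "'k \<times> 'k \<times> 'k \<times> 'k"
    obtain s x y z where "c = (s, x, y, z)" by (metis prod_cases4)
    then show "card {t. t \<notin> ?M \<and> (case c of (s, x, y, z) \<Rightarrow> z = - t * (y + s))} =
      (if P c then 1 else if R c then card (- ?M) else 0)"
      by (simp only: prod.case P_def R_def card_fibre_over_cubic)
  qed
  also have "\<dots> = 1 * card {c\<in>?C. P c} + card (- ?M) * card {c\<in>?C. \<not> P c \<and> R c}"
    by (rule sum_if_if) simp
  also have "{c\<in>?C. P c} = ?A2" by (auto simp: P_def)
  also have "{c\<in>?C. \<not> P c \<and> R c} = ?Z" by (auto simp: P_def R_def)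
  finally have main: "quartic_count UNIV UNIV UNIV (- ?M) = int (card ?A2) + (q - m) * (q * m)"
    by (simp add: quartic_count_eq_cubic card_compl_cube_roots_minus_1
        card_cubic_points_opposite_zero q_def m_def)
  have "?C = ?A0 \<union> (?A1 \<union> ?A2)" by auto
  then have "card ?C = card (?A0 \<union> (?A1 \<union> ?A2))" by (rule arg_cong)
  also have "\<dots> = card ?A0 + (card ?A1 + card ?A2)"
    by (subst card_Un_disjoint, simp, simp, force, subst card_Un_disjoint, simp, simp, force) simp
  finally have A2: "int (card ?A2) = int (card ?C) - int (card ?A0) - int (card ?A1)" by simp
  \<comment> \<open>On \<open>z = y + s\<close>, the points with \<open>z = 0\<close> are exactly
    those of \<open>?Z\<close>.\<close>
  have "?H = ?H' \<union> ?Z" by auto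
  then have "card ?H = card (?H' \<union> ?Z)" by (rule arg_cong)
  also have "\<dots> = card ?H' + card ?Z" by (rule card_Un_disjoint) auto
  finally have "int (card ?H) = int (card ?H') + int (card ?Z)" by (simp only: of_nat_add)
  then have H': "int (card ?H') = T + q * (m * r) - q * m"
    unfolding card_cubic_points_hyperplane[OF three] card_cubic_points_opposite_zero
      T_def q_def m_def r_def of_nat_add of_nat_mult by linarith
  have q1: "int (CARD('k) - 1) = q - 1" by (simp add: q_def of_nat_diff Suc_le_eq)
  have "int (card ?A1) = m * (T + q * (m * r) - q * m)"
    unfolding card_cubic_points_cone[OF three] of_nat_mult H' m_def ..
  moreover have "int (card ?A0) = (q - 1)\<^sup>2 + q * (2 * m)"
    unfolding card_cubic_points_opposite[OF three] of_nat_add of_nat_mult of_nat_power q1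
    by (simp add: q_def m_def)
  moreover have "int (card ?C) = (q - m) * T + m * n"
    unfolding card_cubic_points[OF three] q_def m_def T_def n_def ..
  ultimately show ?thesis unfolding main A2 by (simp add: algebra_simps)
qed

section \<open>Quartic points with prescribed coordinates among the cube roots of -1\<close>

text \<open>For \<open>u^3 = -1\<close> the terms \<open>1 + u^3\<close> cancel and \<open>f\<close>
  becomes the norm of \<open>(v, s, - u * t)\<close>.\<close>

lemma quartic_count_bad1:
  "quartic_count (cube_roots_minus_1 :: 'k::{field,finite} set) UNIV UNIV UNIV =
    int (mu TYPE('k)) * int (norm3_zeros TYPE('k))"
proof -
  let ?M = "cube_roots_minus_1 :: 'k set"
  have slice: "card {(v, s, t). quartic_explicit 1 u v s t = 0} = norm3_zeros TYPE('k)"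
    if "u \<in> ?M" for u
  proof -
    have u: "u ^ 3 = -1" "u \<noteq> 0" using that by (auto simp: cube_roots_minus_1_def)
    have norm: "norm3 v s (- u * t) = quartic_explicit 1 u v s t" for v s t
      using u(1) by (simp add: norm3_def quartic_explicit_def power_mult_distrib)
    have "bij_betw (\<lambda>(v, s, t). (v, s, - u * t)) {(v, s, t). quartic_explicit 1 u v s t = 0}
      {(x, y, z). norm3 x y z = 0}"
    proof (rule bij_betw_byWitness[where f' = "\<lambda>(x, y, z). (x, y, - (z / u))"])
      show "(\<lambda>(x, y, z). (x, y, - (z / u))) ` {(x, y, z). norm3 x y z = 0} \<subseteq>
          {(v, s, t). quartic_explicit 1 u v s t = 0}"
        using u(2) by (auto simp: norm[symmetric])
    qed (use u(2) norm in auto)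
    then show ?thesis unfolding norm3_zeros_def by (rule bij_betw_same_card)
  qed
  have "{(u, v, s, t). quartic_explicit 1 u v s t = 0 \<and> u \<in> ?M \<and> v \<in> UNIV \<and> s \<in> UNIV \<and> t \<in> UNIV} =
    Sigma ?M (\<lambda>u. {(v, s, t). quartic_explicit 1 u v s t = 0})" by auto
  then show ?thesis by (simp add: quartic_count_def slice)
qed

text \<open>Two such cubes turn the constant into -1, so up to sign \<open>f\<close> is the norm
  with first entry 1.\<close>

lemma quartic_count_bad2:
  "quartic_count (cube_roots_minus_1 :: 'k::{field,finite} set) cube_roots_minus_1 UNIV UNIV =
    int (mu TYPE('k)) ^ 2 * int (norm3_affine_zeros TYPE('k))"
proof -
  let ?M = "cube_roots_minus_1 :: 'k set"
  have slice: "card {(s, t). quartic_explicit 1 u v s t = 0} = norm3_affine_zeros TYPE('k)"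
    if "u \<in> ?M" "v \<in> ?M" for u v
  proof -
    have uv: "u ^ 3 = -1" "v ^ 3 = -1" "u \<noteq> 0" "v \<noteq> 0"
      using that by (auto simp: cube_roots_minus_1_def)
    have norm: "norm3 1 (- s) (- (u * v * t)) = - quartic_explicit 1 u v s t" for s t
      using uv(1,2) by (simp add: norm3_def quartic_explicit_def power_mult_distrib algebra_simps)
    have "bij_betw (\<lambda>(s, t). (- s, - (u * v * t))) {(s, t). quartic_explicit 1 u v s t = 0}
      {(y, z). norm3 1 y z = 0}"
    proof (rule bij_betw_byWitness[where f' = "\<lambda>(y, z). (- y, - (z / (u * v)))"])
      have "quartic_explicit 1 u v (- y) (- (z / (u * v))) = 0" if "norm3 1 y z = 0" for y z
        using norm[of "- y" "- (z / (u * v))"] uv(3,4) that by simp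
      then show "(\<lambda>(y, z). (- y, - (z / (u * v)))) ` {(y, z). norm3 1 y z = 0} \<subseteq>
          {(s, t). quartic_explicit 1 u v s t = 0}" by auto
      show "(\<lambda>(s, t). (- s, - (u * v * t))) ` {(s, t). quartic_explicit 1 u v s t = 0} \<subseteq>
          {(y, z). norm3 1 y z = 0}"
        by (auto simp: norm)
    qed (use uv(3,4) in auto)
    then show ?thesis unfolding norm3_affine_zeros_def by (rule bij_betw_same_card)
  qed
  have "{(u, v, s, t). quartic_explicit 1 u v s t = 0 \<and> u \<in> ?M \<and> v \<in> ?M \<and> s \<in> UNIV \<and> t \<in> UNIV} =
    Sigma ?M (\<lambda>u. Sigma ?M (\<lambda>v. {(s, t). quartic_explicit 1 u v s t = 0}))" by auto
  then show ?thesis by (simp add: quartic_count_def slice power2_eq_square)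
qed

text \<open>With \<open>k = u * v * s\<close> the equation is
  \<open>t^3 + 3 * k * t - 2 = 0\<close>, which has a double root \<open>- k^2\<close> and the root
  \<open>2 * k^2\<close>; these differ since 3 is nonzero.\<close>

lemma quartic_count_bad3:
  assumes three: "(3::'k::{field,finite}) \<noteq> 0"
  shows "quartic_count (cube_roots_minus_1 :: 'k set) cube_roots_minus_1 cube_roots_minus_1 UNIV =
    2 * int (mu TYPE('k)) ^ 3"
proof -
  let ?M = "cube_roots_minus_1 :: 'k set"
  have slice: "card {t. quartic_explicit 1 u v s t = 0} = 2"
    if "u \<in> ?M" "v \<in> ?M" "s \<in> ?M" for u v s
  proof -
    have uvs: "u ^ 3 = -1" "v ^ 3 = -1" "s ^ 3 = -1"
      using that by (auto simp: cube_roots_minus_1_def)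
    define k where "k = u * v * s"
    have k3: "k ^ 3 = -1" unfolding k_def power_mult_distrib uvs by simp
    have k0: "k \<noteq> 0" using k3 by auto
    have "quartic_explicit 1 u v s t = (t + k\<^sup>2)\<^sup>2 * (t - 2 * k\<^sup>2)" for t
    proof -
      have "(t + k\<^sup>2)\<^sup>2 * (t - 2 * k\<^sup>2) = t ^ 3 - 3 * (k ^ 3) * k * t - 2 * (k ^ 3)\<^sup>2"
        by (simp add: algebra_simps power_numeral_reduce)
      also have "\<dots> = quartic_explicit 1 u v s t"
        unfolding k3 using uvs by (simp add: quartic_explicit_def k_def)
      finally show ?thesis by simp
    qed
    then have "{t. quartic_explicit 1 u v s t = 0} = {- k\<^sup>2, 2 * k\<^sup>2}"
      by (auto simp: eq_neg_iff_add_eq_0)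
    moreover have "- k\<^sup>2 \<noteq> 2 * k\<^sup>2"
    proof
      assume double: "- k\<^sup>2 = 2 * k\<^sup>2"
      have "3 * k\<^sup>2 = 2 * k\<^sup>2 - (- k\<^sup>2)" by simp
      also have "\<dots> = 0" unfolding double by (rule diff_self)
      finally show False using three k0 by simp
    qed
    ultimately show ?thesis by (simp add: card_insert_if)
  qed
  have "{(u, v, s, t). quartic_explicit 1 u v s t = 0 \<and> u \<in> ?M \<and> v \<in> ?M \<and> s \<in> ?M \<and> t \<in> UNIV} =
    Sigma ?M (\<lambda>u. Sigma ?M (\<lambda>v. Sigma ?M (\<lambda>s. {t. quartic_explicit 1 u v s t = 0})))" by auto
  then show ?thesis by (simp add: quartic_count_def slice power3_eq_cube)
qed

text \<open>The equation reduces to \<open>3 * (k * t - 1) = 0\<close>, and \<open>1 / k\<close> is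
  again a cube root of -1.\<close>

lemma quartic_count_bad4:
  assumes three: "(3::'k::{field,finite}) \<noteq> 0"
  shows "quartic_count (cube_roots_minus_1 :: 'k set) cube_roots_minus_1 cube_roots_minus_1
      cube_roots_minus_1 = int (mu TYPE('k)) ^ 3"
proof -
  let ?M = "cube_roots_minus_1 :: 'k set"
  have slice: "card {t \<in> ?M. quartic_explicit 1 u v s t = 0} = 1"
    if "u \<in> ?M" "v \<in> ?M" "s \<in> ?M" for u v s
  proof -
    have uvs: "u ^ 3 = -1" "v ^ 3 = -1" "s ^ 3 = -1"
      using that by (auto simp: cube_roots_minus_1_def)
    define k where "k = u * v * s"
    have k3: "k ^ 3 = -1" unfolding k_def power_mult_distrib uvs by simp
    have k0: "k \<noteq> 0" using k3 by auto
    have "quartic_explicit 1 u v s t = 3 * (k * t - 1)" if "t ^ 3 = -1" for t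
      using that uvs by (simp add: quartic_explicit_def k_def algebra_simps)
    then have "quartic_explicit 1 u v s t = 0 \<longleftrightarrow> k * t = 1" if "t \<in> ?M" for t
      using that three by (simp add: cube_roots_minus_1_def)
    then have "quartic_explicit 1 u v s t = 0 \<longleftrightarrow> t = 1 / k" if "t \<in> ?M" for t
      using that k0 by (auto simp: field_simps)
    moreover have "1 / k \<in> ?M" using k3 by (simp add: cube_roots_minus_1_def power_divide)
    ultimately have "{t \<in> ?M. quartic_explicit 1 u v s t = 0} = {1 / k}" by blast
    then show ?thesis by simp
  qed
  have "{(u, v, s, t). quartic_explicit 1 u v s t = 0 \<and> u \<in> ?M \<and> v \<in> ?M \<and> s \<in> ?M \<and> t \<in> ?M} =
    Sigma ?M (\<lambda>u. Sigma ?M (\<lambda>v. Sigma ?M (\<lambda>s. {t \<in> ?M. quartic_explicit 1 u v s t = 0})))" by auto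
  then show ?thesis by (simp add: quartic_count_def slice power3_eq_cube)
qed

section \<open>Symmetry, inclusion and exclusion\<close>

lemma quartic_explicit_swap:
  "quartic_explicit a v u s t = quartic_explicit a u v s t"
  "quartic_explicit a u s v t = quartic_explicit a u v s t"
  "quartic_explicit a u v t s = quartic_explicit a u v s t"
  by (simp_all add: quartic_explicit_def algebra_simps)

text \<open>Adjacent transpositions generate all permutations, so only the number of restricted
  coordinates matters.\<close>

lemma quartic_count_swap:
  "quartic_count B A C D = quartic_count A B C D"
  "quartic_count A C B D = quartic_count A B C D"
  "quartic_count A B D C = quartic_count A B C D"
proof -
  show "quartic_count B A C D = quartic_count A B C D"
    unfolding quartic_count_def of_nat_eq_iff
    by (rule bij_betw_same_card[OF bij_betw_byWitness[where f = "\<lambda>(u, v, s, t). (v, u, s, t)"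
          and f' = "\<lambda>(u, v, s, t). (v, u, s, t)"]]) (auto simp: quartic_explicit_swap)
  show "quartic_count A C B D = quartic_count A B C D"
    unfolding quartic_count_def of_nat_eq_iff
    by (rule bij_betw_same_card[OF bij_betw_byWitness[where f = "\<lambda>(u, v, s, t). (u, s, v, t)"
          and f' = "\<lambda>(u, v, s, t). (u, s, v, t)"]]) (auto simp: quartic_explicit_swap)
  show "quartic_count A B D C = quartic_count A B C D"
    unfolding quartic_count_def of_nat_eq_iff
    by (rule bij_betw_same_card[OF bij_betw_byWitness[where f = "\<lambda>(u, v, s, t). (u, v, t, s)"
          and f' = "\<lambda>(u, v, s, t). (u, v, t, s)"]]) (auto simp: quartic_explicit_swap)
qed

lemma quartic_count_Compl:
  "quartic_count (- A) B C D = quartic_count UNIV B C D - quartic_count A B C D"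
proof -
  let ?S = "\<lambda>X. {(u, v, s, t). quartic_explicit 1 u v s t = 0 \<and> u \<in> X \<and> v \<in> B \<and> s \<in> C \<and> t \<in> D}"
  have "?S UNIV = ?S A \<union> ?S (- A)" by auto
  then have "card (?S UNIV) = card (?S A \<union> ?S (- A))" by (rule arg_cong)
  also have "\<dots> = card (?S A) + card (?S (- A))" by (rule card_Un_disjoint) auto
  finally show ?thesis by (simp add: quartic_count_def)
qed

text \<open>The binomial signs are 1, -4, 6, -4, 1. The first term already has a good last
  coordinate and absorbs one of the four single restrictions, leaving 3.\<close>

lemma quartic_count_good:
  assumes three: "(3::'k::{field,finite}) \<noteq> 0"
  defines "M \<equiv> cube_roots_minus_1 :: 'k set"
  shows "quartic_count (- M) (- M) (- M) (- M) =
    quartic_count UNIV UNIV UNIV (- M) - 3 * quartic_count M UNIV UNIV UNIV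
    + 6 * quartic_count M M UNIV UNIV - 4 * quartic_count M M M UNIV + quartic_count M M M M"
proof -
  note Compl1 = quartic_count_Compl[of M]
  have Compl2: "quartic_count A (- M) C D = quartic_count A UNIV C D - quartic_count A M C D"
    for A C D using Compl1[of A C D] by (simp add: quartic_count_swap(1)[of _ A])
  have Compl3: "quartic_count A B (- M) D = quartic_count A B UNIV D - quartic_count A B M D"
    for A B D using Compl2[of A B D] by (simp add: quartic_count_swap(2)[of A _ B])
  have Compl4: "quartic_count A B C (- M) = quartic_count A B C UNIV - quartic_count A B C M"
    for A B C using Compl3[of A B C] by (simp add: quartic_count_swap(3)[of A B _ C])
  have swaps:
    "quartic_count UNIV M B C = quartic_count M UNIV B C"
    "quartic_count B UNIV M C = quartic_count B M UNIV C"
    "quartic_count B C UNIV M = quartic_count B C M UNIV" for B C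
    by (rule quartic_count_swap)+
  show ?thesis unfolding Compl1 Compl2 Compl3 Compl4 by (simp add: swaps)
qed

theorem corollary2p4:
  fixes q :: nat
  assumes "primepow q"
    and "\<not> 3 dvd q"
    and "CARD('k::{field, finite}) = q"
  shows "int (card (quartic_threefold - hessian_threefold :: ('k ^ 5) set set)) =
    (if q mod 3 = 1 then (int q - 4) * (int q - 7) * (int q - 13)
     else (int q - 2) * ((int q)\<^sup>2 - 2 * int q - 1))"
proof -
  let ?M = "cube_roots_minus_1 :: 'k set" and ?r = "int (card (primitive_cube_roots :: 'k set))"
  \<comment> \<open>If 3 vanished, the characteristic would be 3 and would divide the order of the
    field.\<close>
  have three: "(3::'k) \<noteq> 0"
  proof
    assume "(3::'k) = 0"
    then have "CHAR('k) dvd 3" using of_nat_eq_0_iff_char_dvd[of 3, where 'a = 'k] by simp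
    moreover have "prime (3::nat)" by simp
    ultimately have "CHAR('k) = 3" using CHAR_not_1' by (metis One_nat_def prime_nat_iff)
    then show False using CHAR_dvd_CARD[where 'a = 'k] assms(2,3) by simp
  qed
  have "card (quartic_threefold - hessian_threefold :: ('k ^ 5) set set) =
      card (affine_points_off_hessian :: ('k \<times> 'k \<times> 'k \<times> 'k) set)"
    using bij_betw_same_card[OF bij_betw_quartic_minus_hessian[OF three]] by simp
  then have main: "int (card (quartic_threefold - hessian_threefold :: ('k ^ 5) set set)) =
      quartic_count (- ?M) (- ?M) (- ?M) (- ?M)"
    by (simp add: quartic_count_def affine_points_off_hessian_def cube_roots_minus_1_def)
  have q1: "int q \<noteq> 1"
    using card_mono[of UNIV "{0, 1 :: 'k}"] assms(3) by auto
  have mu: "int (mu TYPE('k)) = 1 + ?r"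
    by (simp add: card_cube_roots_minus_1[OF three])
  define n where "n = int (norm3_affine_zeros TYPE('k))"
  have T: "int (torus_card TYPE('k)) = (int q)\<^sup>2 - 1 - (int q - 1) * ?r"
    using torus_card_eq[where 'k = 'k] assms(3) by simp
  have zeros: "int (norm3_zeros TYPE('k)) = int q ^ 3 - (int q - 1) * int (torus_card TYPE('k))"
    using norm3_zeros_eq[OF three] assms(3) by simp
  have "int (norm3_zeros TYPE('k)) = 1 + (int q - 1) * (int (mu TYPE('k)) + n)"
    using norm3_zeros_eq_affine[where 'k = 'k] assms(3) by (simp add: n_def)
  \<comment> \<open>The two counts of norm zeros are equated; cancelling \<open>q - 1\<close>
    determines \<open>n\<close>.\<close>
  then have "(int q - 1) * (int (mu TYPE('k)) + n) =
      (int q - 1) * ((int q)\<^sup>2 + int q + 1 - int (torus_card TYPE('k)))"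
    unfolding zeros by (simp add: algebra_simps power_numeral_reduce)
  then have n: "n = (int q)\<^sup>2 + int q + 1 - int (torus_card TYPE('k)) - int (mu TYPE('k))"
    using q1 by simp
  have r: "?r = (if q mod 3 = 1 then 2 else 0)"
    using card_primitive_cube_roots[OF three] assms(3) by simp
  \<comment> \<open>Every count is now a polynomial in q and the number of primitive cube roots; the
    values 2 and 0 give the two formulas.\<close>
  show ?thesis
    unfolding main quartic_count_good[OF three] quartic_count_good_last[OF three]
      quartic_count_bad1 quartic_count_bad2 quartic_count_bad3[OF three] quartic_count_bad4[OF three]
      assms(3) n_def[symmetric] n zeros T mu r
    by (simp add: algebra_simps power_numeral_reduce)
qed

end
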